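(* Let $\Omega\subset\mathbb{R}^n$ be a domain with boundary of class $C^2$ satisfying a uniform interior sphere condition. If $s\ge1$ then $\mathcal{B}_1(\Omega)\ge(n-1)\underline{\mathcal{H}}$, where $\underline{\mathcal{H}}:=\inf_{y\in\partial\Omega}\mathcal{H}(y)$.
   Context: $d(x):=\operatorname{dist}(x,\mathbb{R}^n\setminus\Omega)$. $\Omega$ satisfies a uniform interior sphere condition if there is $r>0$ such that for every $y\in\partial\Omega$ there is an open ball of radius $r$ contained in $\Omega$ whose boundary contains $y$. $\mathcal{H}(y):=\frac1{n-1}\sum_{i=1}^{n-1}\kappa_i(y)$ is the mean curvature, $\kappa_i$ the principal curvatures of $\partial\Omega$, with the convention that the sphere bounding a ball of radius $R$ has all $\kappa_i=1/R$. For $s\ge1$, $\mathcal{B}_1(\Omega):=\inf\Big\{\frac{\int_\Omega |\nabla u|d^{1-s}dx-(s-1)\int_\Omega|u|d^{-s}dx}{\int_\Omega|u|d^{1-s}dx}: u\in C_c^\infty(\Omega)\setminus\{0\}\Big\}$. *)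

theory Defs
  imports "HOL-Analysis.Analysis"
begin

definition pderiv :: "'a::euclidean_space \<Rightarrow> ('a \<Rightarrow> real) \<Rightarrow> 'a \<Rightarrow> real" where
  "pderiv b f x = deriv (\<lambda>t. f (x + t *\<^sub>R b)) 0"

fun Ck_on :: "nat \<Rightarrow> 'a::euclidean_space set \<Rightarrow> ('a \<Rightarrow> real) \<Rightarrow> bool" where
  "Ck_on 0 S f = continuous_on S f"
| "Ck_on (Suc k) S f =
     (continuous_on S f \<and>
      (\<forall>x\<in>S. \<forall>b\<in>Basis. (\<lambda>t. f (x + t *\<^sub>R b)) differentiable (at 0)) \<and>
      (\<forall>b\<in>Basis. Ck_on k S (pderiv b f)))"

definition smooth_on :: "'a::euclidean_space set \<Rightarrow> ('a \<Rightarrow> real) \<Rightarrow> bool" where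
  "smooth_on S f \<longleftrightarrow> (\<forall>k. Ck_on k S f)"

definition grad :: "('a::euclidean_space \<Rightarrow> real) \<Rightarrow> 'a \<Rightarrow> 'a" where
  "grad f x = (\<Sum>b\<in>Basis. pderiv b f x *\<^sub>R b)"

definition test_functions :: "'a::euclidean_space set \<Rightarrow> ('a \<Rightarrow> real) set" where
  "test_functions \<Omega> = {u. smooth_on \<Omega> u \<and> compact (closure {x. u x \<noteq> 0})
      \<and> closure {x. u x \<noteq> 0} \<subseteq> \<Omega> \<and> (\<exists>x. u x \<noteq> 0)}"

definition dist_bd :: "'a::euclidean_space set \<Rightarrow> 'a \<Rightarrow> real" where
  "dist_bd \<Omega> x = infdist x (- \<Omega>)"

definition B1 :: "'a::euclidean_space set \<Rightarrow> real \<Rightarrow> ereal" where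
  "B1 \<Omega> s = (INF u\<in>test_functions \<Omega>.
     ereal (((LINT x:\<Omega>|lborel. norm (grad u x) * dist_bd \<Omega> x powr (1 - s))
             - (s - 1) * (LINT x:\<Omega>|lborel. \<bar>u x\<bar> * dist_bd \<Omega> x powr (- s)))
            / (LINT x:\<Omega>|lborel. \<bar>u x\<bar> * dist_bd \<Omega> x powr (1 - s))))"

text \<open>Local graph representation of the boundary at y: in the orthogonal coordinates
  (z,t) with z orthogonal to the unit inner normal nu, Omega is locally {t > phi z},
  with phi of class C^2, phi 0 = 0 and zero tangential derivative at 0.\<close>
definition graph_rep :: "'a::euclidean_space set \<Rightarrow> 'a \<Rightarrow> 'a \<Rightarrow> real \<Rightarrow> ('a \<Rightarrow> real) \<Rightarrow> bool" where
  "graph_rep \<Omega> y \<nu> \<delta> \<phi> \<longleftrightarrow>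
     norm \<nu> = 1 \<and> \<delta> > 0 \<and> Ck_on 2 (ball 0 \<delta>) \<phi> \<and> \<phi> 0 = 0 \<and>
     (\<forall>z. z \<bullet> \<nu> = 0 \<longrightarrow> ((\<lambda>t. \<phi> (t *\<^sub>R z)) has_real_derivative 0) (at 0)) \<and>
     (\<forall>z t. z \<bullet> \<nu> = 0 \<longrightarrow> norm z < \<delta> \<longrightarrow> \<bar>t\<bar> < \<delta> \<longrightarrow>
        (y + z + t *\<^sub>R \<nu> \<in> \<Omega> \<longleftrightarrow> \<phi> z < t))"

definition C2_boundary :: "'a::euclidean_space set \<Rightarrow> bool" where
  "C2_boundary \<Omega> \<longleftrightarrow> (\<forall>y\<in>frontier \<Omega>. \<exists>\<nu> \<delta> \<phi>. graph_rep \<Omega> y \<nu> \<delta> \<phi>)"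

definition uniform_interior_sphere :: "'a::euclidean_space set \<Rightarrow> bool" where
  "uniform_interior_sphere \<Omega> \<longleftrightarrow>
     (\<exists>r>0. \<forall>y\<in>frontier \<Omega>. \<exists>c. ball c r \<subseteq> \<Omega> \<and> y \<in> sphere c r)"

text \<open>Sum of the principal curvatures at y: the trace of the second fundamental form,
  i.e. the trace of the Hessian of phi at 0 restricted to the tangent hyperplane,
  computed in an orthonormal basis E of the tangent hyperplane.\<close>
definition curvature_sum :: "'a::euclidean_space set \<Rightarrow> 'a \<Rightarrow> real" where
  "curvature_sum \<Omega> y = (SOME c. \<exists>\<nu> \<delta> \<phi> E. graph_rep \<Omega> y \<nu> \<delta> \<phi> \<and>
      finite E \<and> card E = DIM('a) - 1 \<and> (\<forall>e\<in>E. norm e = 1 \<and> e \<bullet> \<nu> = 0) \<and>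
      (\<forall>e\<in>E. \<forall>e'\<in>E. e \<noteq> e' \<longrightarrow> e \<bullet> e' = 0) \<and>
      c = (\<Sum>e\<in>E. deriv (deriv (\<lambda>t. \<phi> (t *\<^sub>R e))) 0))"

text \<open>Mean curvature: average of the principal curvatures (sphere of radius R gives 1/R).\<close>
definition mean_curvature :: "'a::euclidean_space set \<Rightarrow> 'a \<Rightarrow> real" where
  "mean_curvature \<Omega> y = curvature_sum \<Omega> y / real (DIM('a) - 1)"

end

theory Submission
  imports Defs
begin

text \<open>
  Let \<open>d\<close> be the distance to the complement, \<open>G\<close> a primitive of \<open>t powr (1 - s)\<close> and
  \<open>w = G \<circ> d\<close>. At a point \<open>x = y + d(x) \<nu>\<close> with nearest boundary point \<open>y\<close>, comparing
  \<open>x + z + t \<nu>\<close> (\<open>z\<close> tangential) with the boundary point \<open>y + z + \<phi>(z) \<nu>\<close> gives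
  \<open>d(x + z + t \<nu>) \<le> d(x) + t - \<phi>(z)\<close>. Hence \<open>w\<close> is touched from above at every point by a
  \<open>C\<^sup>2\<close> function with Laplacian \<open>- (s - 1) d powr (- s) - tr(D\<^sup>2 \<phi>(0)) d powr (1 - s)\<close>.
  Instead of passing to distributional derivatives, one integrates the discrete Laplacian of \<open>w\<close>
  against \<open>\<bar>u\<bar>\<close>. It is bounded above because \<open>w\<close> is semiconcave, so Fatou's lemma turns the
  pointwise upper limits into a lower bound by the curvature and singular terms. Summation by parts
  and the supergradients of \<open>w\<close>, which have length \<open>d powr (1 - s)\<close>, bound the same integral above by
  \<open>\<integral> \<bar>\<nabla>u\<bar> d powr (1 - s)\<close>; no differentiability of \<open>d\<close> is needed.
\<close>

subsection \<open>Second differences and traces of Hessians\<close>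

lemma has_real_derivative_on_line:
  fixes g :: "'a::real_normed_vector \<Rightarrow> real"
  assumes "((\<lambda>r. g ((z + t *\<^sub>R b) + r *\<^sub>R b)) has_real_derivative D) (at 0)"
  shows "((\<lambda>r. g (z + r *\<^sub>R b)) has_real_derivative D) (at t)"
proof -
  have "(\<lambda>r. g ((z + t *\<^sub>R b) + r *\<^sub>R b)) = (\<lambda>r. g (z + (r + t) *\<^sub>R b))"
    by (simp add: scaleR_add_left add.assoc add.commute add.left_commute)
  with assms have "((\<lambda>r. g (z + (r + t) *\<^sub>R b)) has_real_derivative D) (at 0)"
    by simp
  then show ?thesis
    using DERIV_shift[of "\<lambda>r. g (z + r *\<^sub>R b)" D 0 t] by simp
qed

text \<open>\<open>Ck_on\<close> controls derivatives along the coordinate axes only, whereas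
  tangential directions are oblique. Moving from \<open>x\<close> to \<open>x + h\<close> one
  coordinate at a time, the mean value inequality on each segment compares the increment with the
  partial derivative at \<open>x\<close>.\<close>

lemma has_derivative_continuous_partials:
  fixes g :: "'a::euclidean_space \<Rightarrow> real"
  assumes "open S" "x \<in> S"
    and der: "\<And>y b. y \<in> S \<Longrightarrow> b \<in> Basis \<Longrightarrow>
      ((\<lambda>t. g (y + t *\<^sub>R b)) has_real_derivative g' b y) (at 0)"
    and cont: "\<And>b. b \<in> Basis \<Longrightarrow> continuous_on S (g' b)"
  shows "(g has_derivative (\<lambda>h. \<Sum>b\<in>Basis. (h \<bullet> b) * g' b x)) (at x)"
  unfolding has_derivative_at_alt
proof (intro conjI allI impI)
  show "bounded_linear (\<lambda>h. \<Sum>b\<in>Basis. (h \<bullet> b) * g' b x)"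
    by (intro bounded_linear_intros)
next
  fix e :: real assume "e > 0"
  define n where "n = real DIM('a)"
  have n: "n > 0" by (simp add: n_def)
  \<comment> \<open>Each of the \<open>n\<close> coordinate moves will cost an error of at most
    \<open>e' * norm h\<close>.\<close>
  define e' where "e' = e / n"
  have e': "e' > 0" using \<open>e > 0\<close> n by (simp add: e'_def)
  have "\<forall>b\<in>Basis. \<exists>d>0. \<forall>y\<in>ball x d. \<bar>g' b y - g' b x\<bar> \<le> e'"
  proof
    fix b :: 'a assume "b \<in> Basis"
    then have "isCont (g' b) x"
      using cont \<open>open S\<close> \<open>x \<in> S\<close> by (simp add: continuous_on_eq_continuous_at)
    then obtain d where "d > 0" "\<forall>y. dist y x < d \<longrightarrow> dist (g' b y) (g' b x) < e'"
      using e' unfolding continuous_at_eps_delta by blast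
    then show "\<exists>d>0. \<forall>y\<in>ball x d. \<bar>g' b y - g' b x\<bar> \<le> e'"
      by (intro exI[of _ d]) (auto simp: dist_real_def dist_commute less_imp_le)
  qed
  then obtain D where D: "\<And>b. b \<in> Basis \<Longrightarrow> D b > 0"
    "\<And>b y. b \<in> Basis \<Longrightarrow> y \<in> ball x (D b) \<Longrightarrow> \<bar>g' b y - g' b x\<bar> \<le> e'"
    by metis
  obtain d0 where d0: "d0 > 0" "ball x d0 \<subseteq> S"
    using assms(1,2) open_contains_ball by blast
  define d where "d = min d0 (Min (D ` Basis))"
  have d: "d > 0" "ball x d \<subseteq> S" using d0 D(1) by (auto simp: d_def)
  have dD: "\<bar>g' b y - g' b x\<bar> \<le> e'" if "b \<in> Basis" "y \<in> ball x d" for b y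
  proof (rule D(2)[OF that(1)])
    have "d \<le> D b" using that(1) by (simp add: d_def min_le_iff_disj)
    then show "y \<in> ball x (D b)" using that(2) by auto
  qed
  show "\<exists>d>0. \<forall>y. norm (y - x) < d \<longrightarrow>
      norm (g y - g x - (\<Sum>b\<in>Basis. ((y - x) \<bullet> b) * g' b x)) \<le> e * norm (y - x)"
  proof (intro exI conjI allI impI)
    \<comment> \<open>The corners of the coordinate path are only bounded by
      \<open>n * norm h\<close>, so this radius keeps the whole path inside
      \<open>ball x d\<close>.\<close>
    show "d / n > 0" using d n by simp
    fix y assume y: "norm (y - x) < d / n"
    define h where "h = y - x"
    have hn: "n * norm h < d" using y n by (simp add: h_def field_simps)
    have bnd: "norm (\<Sum>b\<in>A. (h \<bullet> b) *\<^sub>R b) \<le> real (card A) * norm h" if "A \<subseteq> Basis" for A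
    proof -
      have "norm (\<Sum>b\<in>A. (h \<bullet> b) *\<^sub>R b) \<le> (\<Sum>b\<in>A. norm h)"
        using that Basis_le_norm[of _ h] by (intro sum_norm_le) (auto simp: subset_iff)
      then show ?thesis by simp
    qed
    have *: "A \<subseteq> Basis \<Longrightarrow> \<bar>g (x + (\<Sum>b\<in>A. (h \<bullet> b) *\<^sub>R b)) - g x - (\<Sum>b\<in>A. (h \<bullet> b) * g' b x)\<bar>
       \<le> real (card A) * (e' * norm h)" if "finite A" for A
      using that
    proof (induction A rule: finite_induct)
      case empty then show ?case by simp
    next
      case (insert c A)
      define z where "z = x + (\<Sum>b\<in>A. (h \<bullet> b) *\<^sub>R b)"
      have c: "c \<in> Basis" "A \<subseteq> Basis" using insert by auto
      have cd: "real (card A) + 1 \<le> n"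
        using insert card_mono[of Basis "insert c A"] by (simp add: n_def)
      have inb: "z + t *\<^sub>R c \<in> ball x d" if "\<bar>t\<bar> \<le> \<bar>h \<bullet> c\<bar>" for t
      proof -
        have "norm (z + t *\<^sub>R c - x) \<le> norm (\<Sum>b\<in>A. (h \<bullet> b) *\<^sub>R b) + norm (t *\<^sub>R c)"
          using norm_triangle_ineq[of "\<Sum>b\<in>A. (h \<bullet> b) *\<^sub>R b" "t *\<^sub>R c"] by (simp add: z_def)
        also have "\<dots> \<le> real (card A) * norm h + norm h"
          using bnd[OF c(2)] that Basis_le_norm[OF c(1), of h] c(1) by (intro add_mono) auto
        also have "\<dots> = (real (card A) + 1) * norm h" by (simp add: algebra_simps)
        also have "\<dots> \<le> n * norm h" using cd by (intro mult_right_mono) auto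
        finally show ?thesis using hn by (simp add: dist_norm norm_minus_commute)
      qed
      \<comment> \<open>Removing the linear part leaves a function whose derivative on the segment
        is at most \<open>e'\<close> in absolute value.\<close>
      define \<psi> where "\<psi> t = g (z + t *\<^sub>R c) - t * g' c x" for t
      have "norm (\<psi> (h \<bullet> c) - \<psi> 0) \<le> e' * norm (h \<bullet> c - 0)"
      proof (rule field_differentiable_bound[where f = \<psi> and f' = "\<lambda>t. g' c (z + t *\<^sub>R c) - g' c x"])
        show "convex {- \<bar>h \<bullet> c\<bar> .. \<bar>h \<bullet> c\<bar>}" by simp
        fix t assume "t \<in> {- \<bar>h \<bullet> c\<bar> .. \<bar>h \<bullet> c\<bar>}"
        then have t: "z + t *\<^sub>R c \<in> ball x d" by (intro inb) auto
        have "((\<lambda>t. g (z + t *\<^sub>R c)) has_real_derivative g' c (z + t *\<^sub>R c)) (at t)"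
          using has_real_derivative_on_line[OF der[of "z + t *\<^sub>R c" c]] t d c by blast
        from DERIV_diff[OF this DERIV_cmult_right[OF DERIV_ident]]
        have "(\<psi> has_field_derivative g' c (z + t *\<^sub>R c) - g' c x) (at t)"
          by (simp add: \<psi>_def[abs_def])
        then show "(\<psi> has_field_derivative g' c (z + t *\<^sub>R c) - g' c x)
            (at t within {- \<bar>h \<bullet> c\<bar> .. \<bar>h \<bullet> c\<bar>})"
          by (rule has_field_derivative_at_within)
        show "norm (g' c (z + t *\<^sub>R c) - g' c x) \<le> e'"
          using dD[OF c(1) t] by simp
      qed auto
      also have "\<dots> \<le> e' * norm h"
        using Basis_le_norm[OF c(1), of h] e' by simp
      finally have 1: "\<bar>g (z + (h \<bullet> c) *\<^sub>R c) - (h \<bullet> c) * g' c x - g z\<bar> \<le> e' * norm h"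
        by (simp add: \<psi>_def)
      have 2: "\<bar>g z - g x - (\<Sum>b\<in>A. (h \<bullet> b) * g' b x)\<bar> \<le> real (card A) * (e' * norm h)"
        using insert.IH c(2) by (simp add: z_def)
      have 3: "x + (\<Sum>b\<in>insert c A. (h \<bullet> b) *\<^sub>R b) = z + (h \<bullet> c) *\<^sub>R c"
        using insert by (simp add: z_def)
      have "\<bar>g (z + (h \<bullet> c) *\<^sub>R c) - g x - ((h \<bullet> c) * g' c x + (\<Sum>b\<in>A. (h \<bullet> b) * g' b x))\<bar>
          \<le> e' * norm h + real (card A) * (e' * norm h)"
        using 1 2 by linarith
      then show ?case unfolding 3 using insert by (simp add: algebra_simps)
    qed
    have "\<bar>g (x + h) - g x - (\<Sum>b\<in>Basis. (h \<bullet> b) * g' b x)\<bar> \<le> n * (e' * norm h)"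
      using *[of Basis] by (simp add: euclidean_representation n_def)
    then show "norm (g y - g x - (\<Sum>b\<in>Basis. ((y - x) \<bullet> b) * g' b x)) \<le> e * norm (y - x)"
      using n by (simp add: h_def e'_def)
  qed
qed

section \<open>Hessian forms, second differences along lines, and traces\<close>

definition hess :: "('a::euclidean_space \<Rightarrow> real) \<Rightarrow> 'a \<Rightarrow> 'a \<Rightarrow> real" where
  "hess \<phi> u v = (\<Sum>b\<in>Basis. \<Sum>c\<in>Basis. (u \<bullet> b) * (v \<bullet> c) * pderiv c (pderiv b \<phi>) 0)"

lemma bilinear_hess: "bilinear (hess \<phi>)"
  unfolding bilinear_def hess_def
  by (intro conjI allI linearI)
    (simp_all add: inner_add_left ring_distribs sum.distrib sum_distrib_left mult.assoc mult.left_commute)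

lemma Ck_on_Suc_has_derivative:
  assumes "Ck_on (Suc k) S f" "open S" "x \<in> S"
  shows "(f has_derivative (\<lambda>h. \<Sum>b\<in>Basis. (h \<bullet> b) * pderiv b f x)) (at x)"
proof (rule has_derivative_continuous_partials[OF assms(2,3)])
  show "continuous_on S (pderiv b f)" if "b \<in> Basis" for b
    using assms(1) that by (cases k) auto
  show "((\<lambda>t. f (y + t *\<^sub>R b)) has_real_derivative pderiv b f y) (at 0)"
    if "y \<in> S" "b \<in> Basis" for y b
    using assms(1) that by (auto simp: pderiv_def DERIV_deriv_iff_real_differentiable)
qed

text \<open>The chain rule is applied twice along \<open>t *\<^sub>R z\<close>. The second
  derivative is delivered at 0 as a derivative of \<open>f1\<close>, which is the form that the
  limit of second difference quotients takes as input.\<close>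

lemma C2_line_derivatives:
  fixes \<phi> :: "'a::euclidean_space \<Rightarrow> real"
  assumes "Ck_on 2 (ball 0 \<delta>) \<phi>" "\<delta> > 0"
  obtains f1 r where "r > 0"
    "\<And>t. \<bar>t\<bar> < r \<Longrightarrow> ((\<lambda>t. \<phi> (t *\<^sub>R z)) has_real_derivative f1 t) (at t)"
    "(f1 has_real_derivative hess \<phi> z z) (at 0)"
proof -
  let ?S = "ball (0::'a) \<delta>"
  have C: "Ck_on (Suc (Suc 0)) ?S \<phi>" using assms(1) by (simp add: numeral_2_eq_2)
  have C1: "Ck_on (Suc 0) ?S (pderiv b \<phi>)" if "b \<in> Basis" for b
    using C that by (subst (asm) Ck_on.simps) blast
  define f1 where "f1 t = (\<Sum>b\<in>Basis. (z \<bullet> b) * pderiv b \<phi> (t *\<^sub>R z))" for t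
  \<comment> \<open>The summand 1 covers the case \<open>z = 0\<close>.\<close>
  define r where "r = \<delta> / (1 + norm z)"
  have n: "1 + norm z > 0" by (simp add: add_pos_nonneg)
  have r: "r > 0" using assms(2) n by (simp add: r_def)
  have inS: "t *\<^sub>R z \<in> ?S" if "\<bar>t\<bar> < r" for t
  proof -
    have "\<bar>t\<bar> * norm z \<le> \<bar>t\<bar> * (1 + norm z)" by (intro mult_left_mono) auto
    also have "\<dots> < \<delta>" using that n by (simp add: r_def field_simps)
    finally show ?thesis by simp
  qed
  have lin: "((\<lambda>t. t *\<^sub>R z) has_derivative (\<lambda>t. t *\<^sub>R z)) (at t)" for t :: real
    by (auto intro!: derivative_eq_intros)
  show thesis
  proof (rule that[OF r])
    fix t :: real assume "\<bar>t\<bar> < r"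
    then have "(\<phi> has_derivative (\<lambda>h. \<Sum>b\<in>Basis. (h \<bullet> b) * pderiv b \<phi> (t *\<^sub>R z))) (at (t *\<^sub>R z))"
      by (intro Ck_on_Suc_has_derivative[OF C] inS) auto
    from has_derivative_compose[OF lin this]
    show "((\<lambda>t. \<phi> (t *\<^sub>R z)) has_real_derivative f1 t) (at t)"
      unfolding has_field_derivative_def
      by (rule has_derivative_eq_rhs) (simp add: f1_def fun_eq_iff sum_distrib_left mult_ac)
  next
    have d1: "((\<lambda>t. pderiv b \<phi> (t *\<^sub>R z)) has_derivative
       (\<lambda>t. t * (\<Sum>c\<in>Basis. (z \<bullet> c) * pderiv c (pderiv b \<phi>) 0))) (at 0)" if "b \<in> Basis" for b
    proof -
      have "(pderiv b \<phi> has_derivative (\<lambda>h. \<Sum>c\<in>Basis. (h \<bullet> c) * pderiv c (pderiv b \<phi>) 0)) (at (0 *\<^sub>R z))"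
        using Ck_on_Suc_has_derivative[OF C1[OF that], of 0] assms(2) by simp
      from has_derivative_compose[OF lin this] show ?thesis
        by (simp add: sum_distrib_left mult_ac)
    qed
    have "((\<lambda>t. pderiv b \<phi> (t *\<^sub>R z)) has_real_derivative
       (\<Sum>c\<in>Basis. (z \<bullet> c) * pderiv c (pderiv b \<phi>) 0)) (at 0)" if "b \<in> Basis" for b
      using d1[OF that] unfolding has_field_derivative_def by (simp add: mult_commute_abs)
    then have "(f1 has_real_derivative (\<Sum>b\<in>Basis. (z \<bullet> b) * (\<Sum>c\<in>Basis. (z \<bullet> c) * pderiv c (pderiv b \<phi>) 0))) (at 0)"
      unfolding f1_def by (intro DERIV_sum DERIV_cmult) auto
    then show "(f1 has_real_derivative hess \<phi> z z) (at 0)"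
      by (simp add: hess_def sum_distrib_left mult_ac)
  qed
qed

text \<open>Differentiability of \<open>f1\<close> at 0 makes the derivative of
  \<open>f t + f (- t) - c * t\<^sup>2\<close> of order o(t); the mean value inequality on
  \<open>{0..e}\<close> turns this into an error o(e^2).\<close>

lemma second_difference_tendsto:
  fixes f :: "real \<Rightarrow> real"
  assumes "r > 0" and f: "\<And>t. \<bar>t\<bar> < r \<Longrightarrow> (f has_real_derivative f1 t) (at t)"
    and f1: "(f1 has_real_derivative c) (at 0)"
  shows "((\<lambda>e. (f e + f (- e) - 2 * f 0) / e\<^sup>2) \<longlongrightarrow> c) (at_right 0)"
  unfolding tendsto_iff
proof (intro allI impI)
  fix \<eta> :: real assume "\<eta> > 0"
  \<comment> \<open>The expansions of \<open>f1\<close> at \<open>t\<close> and \<open>- t\<close>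
    contribute a quarter each; the resulting half is strictly below \<open>\<eta>\<close>.\<close>
  then have "\<eta> / 4 > 0" by simp
  from f1 have "(f1 has_derivative (\<lambda>h. c * h)) (at 0)" by (simp add: has_field_derivative_def)
  with \<open>\<eta>/4 > 0\<close> obtain d where d: "d > 0"
    "\<And>y. \<bar>y\<bar> < d \<Longrightarrow> \<bar>f1 y - f1 0 - c * y\<bar> \<le> \<eta>/4 * \<bar>y\<bar>"
    unfolding has_derivative_at_alt by (metis diff_zero real_norm_def)
  have main: "\<bar>(f e + f (- e) - 2 * f 0) / e\<^sup>2 - c\<bar> < \<eta>" if e: "0 < e" "e < min r d" for e
  proof -
    define k where "k t = f t + f (- t) - c * t\<^sup>2" for t
    have "norm (k e - k 0) \<le> (\<eta>/2 * e) * norm (e - 0)"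
    proof (rule field_differentiable_bound[where f = k and f' = "\<lambda>t. f1 t - f1 (- t) - 2 * c * t"])
      show "convex {0..e}" by simp
      fix t assume t: "t \<in> {0..e}"
      have m: "((\<lambda>t. f (- t)) has_real_derivative - f1 (- t)) (at t)"
        using t e f[of "- t"] DERIV_mirror[where f = f and x = t and y = "f1 (- t)"] by simp
      from DERIV_diff[OF DERIV_add[OF f m] DERIV_cmult[OF DERIV_pow], of c 2] t e
      have "(k has_field_derivative (f1 t - f1 (- t) - 2 * c * t)) (at t)"
        by (simp add: k_def[abs_def] mult_ac)
      then show "(k has_field_derivative (f1 t - f1 (- t) - 2 * c * t)) (at t within {0..e})"
        by (rule has_field_derivative_at_within)
      have "\<bar>f1 t - f1 0 - c * t\<bar> \<le> \<eta>/4 * t" "\<bar>f1 (-t) - f1 0 + c * t\<bar> \<le> \<eta>/4 * t"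
        using d(2)[of t] d(2)[of "-t"] t e by auto
      moreover have "\<eta> / 4 * t \<le> \<eta> / 4 * e" using t \<open>\<eta> > 0\<close> by (intro mult_left_mono) auto
      ultimately show "norm (f1 t - f1 (- t) - 2 * c * t) \<le> \<eta>/2 * e"
        unfolding real_norm_def by linarith
    qed (use e in auto)
    then have "\<bar>f e + f (- e) - c * e\<^sup>2 - 2 * f 0\<bar> \<le> \<eta>/2 * e\<^sup>2"
      using e by (simp add: k_def power2_eq_square)
    moreover have "(f e + f (- e) - 2 * f 0) / e\<^sup>2 - c = (f e + f (- e) - c * e\<^sup>2 - 2 * f 0) / e\<^sup>2"
      using e by (simp add: field_simps)
    ultimately have "\<bar>(f e + f (- e) - 2 * f 0) / e\<^sup>2 - c\<bar> \<le> \<eta>/2"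
      using e by (simp add: field_simps abs_divide)
    then show ?thesis using \<open>\<eta> > 0\<close> by simp
  qed
  show "\<forall>\<^sub>F e in at_right 0. dist ((f e + f (- e) - 2 * f 0) / e\<^sup>2) c < \<eta>"
    unfolding eventually_at_right_field dist_real_def
    using main d(1) \<open>r > 0\<close> by (intro exI[of _ "min r d"]) auto
qed

text \<open>Together with \<open>\<nu>\<close>, the set \<open>E\<close> is an orthonormal basis, so
  the tangential part of each \<open>b\<close> expands in \<open>E\<close>; Parseval over
  \<open>Basis\<close> then leaves only the diagonal terms. This links the coordinate directions of
  the discrete Laplacian with the tangent basis in \<open>curvature_sum\<close>.\<close>

lemma trace_orthonormal_hyperplane:
  fixes E :: "'a::euclidean_space set" and B :: "'a \<Rightarrow> 'a \<Rightarrow> real"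
  assumes B: "bilinear B"
    and E: "finite E" "card E = DIM('a) - 1" "\<And>e. e \<in> E \<Longrightarrow> norm e = 1" "\<And>e. e \<in> E \<Longrightarrow> e \<bullet> \<nu> = 0"
      "\<And>e e'. e \<in> E \<Longrightarrow> e' \<in> E \<Longrightarrow> e \<noteq> e' \<Longrightarrow> e \<bullet> e' = 0"
    and \<nu>: "norm \<nu> = 1"
  shows "(\<Sum>b\<in>Basis. B (b - (b \<bullet> \<nu>) *\<^sub>R \<nu>) (b - (b \<bullet> \<nu>) *\<^sub>R \<nu>)) = (\<Sum>e\<in>E. B e e)"
proof -
  have nE: "\<nu> \<notin> E" using E(4) \<nu> by (metis inner_eq_zero_iff norm_zero zero_neq_one)
  let ?F = "insert \<nu> E"
  have po: "pairwise orthogonal ?F"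
    using E(4,5) by (auto simp: pairwise_def orthogonal_def inner_commute)
  have n1: "norm e = 1" if "e \<in> ?F" for e using that E(3) \<nu> by auto
  have ind: "independent ?F"
    using n1 by (intro pairwise_orthogonal_independent[OF po]) force
  have "card ?F = DIM('a)" using E(1,2) nE DIM_positive[where 'a='a] by simp
  then have "dim (UNIV :: 'a set) \<le> card ?F" by simp
  then have span: "span ?F = UNIV"
    using card_ge_dim_independent[OF _ ind, of UNIV] by auto
  have rep: "(\<Sum>e\<in>?F. (x \<bullet> e) *\<^sub>R e) = x" for x
    using orthonormal_basis_expand[OF po n1, of x] span E(1) by simp
  have P: "b - (b \<bullet> \<nu>) *\<^sub>R \<nu> = (\<Sum>e\<in>E. (b \<bullet> e) *\<^sub>R e)" for b
    using rep[of b] E(1) nE by (simp add: algebra_simps)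
  have "(\<Sum>b\<in>Basis. B (b - (b \<bullet> \<nu>) *\<^sub>R \<nu>) (b - (b \<bullet> \<nu>) *\<^sub>R \<nu>))
      = (\<Sum>b\<in>Basis. \<Sum>(e,e')\<in>E\<times>E. (b \<bullet> e) * (b \<bullet> e') * B e e')"
    unfolding P bilinear_sum[OF B]
    by (simp add: bilinear_lmul[OF B] bilinear_rmul[OF B] mult.assoc mult.left_commute)
  also have "\<dots> = (\<Sum>(e,e')\<in>E\<times>E. (\<Sum>b\<in>Basis. (e \<bullet> b) * (e' \<bullet> b)) * B e e')"
    by (subst sum.swap) (simp add: case_prod_beta sum_distrib_right inner_commute)
  also have "\<dots> = (\<Sum>(e,e')\<in>E\<times>E. (e \<bullet> e') * B e e')"
    by (simp add: euclidean_inner[symmetric])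
  also have "\<dots> = (\<Sum>e\<in>E. \<Sum>e'\<in>E. (if e' = e then B e e else 0))"
    unfolding sum.cartesian_product[symmetric]
  proof (intro sum.cong refl)
    fix e e' assume "e \<in> E" "e' \<in> E"
    then show "(e \<bullet> e') * B e e' = (if e' = e then B e e else 0)"
      using E(3)[of e] E(5)[of e e'] by (auto simp: norm_eq_1)
  qed
  also have "\<dots> = (\<Sum>e\<in>E. B e e)" using E(1) by simp
  finally show ?thesis .
qed

lemma exists_orthonormal_hyperplane_basis:
  fixes \<nu> :: "'a::euclidean_space"
  assumes "norm \<nu> = 1"
  obtains E where "finite E" "card E = DIM('a) - 1" "\<And>e. e \<in> E \<Longrightarrow> norm e = 1 \<and> e \<bullet> \<nu> = 0"
    "\<And>e e'. e \<in> E \<Longrightarrow> e' \<in> E \<Longrightarrow> e \<noteq> e' \<Longrightarrow> e \<bullet> e' = 0"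
proof -
  have nz: "\<nu> \<noteq> 0" using assms by auto
  have sub: "subspace {x. \<nu> \<bullet> x = 0}" by (rule subspace_hyperplane)
  obtain E where E: "E \<subseteq> {x. \<nu> \<bullet> x = 0}" "pairwise orthogonal E" "\<And>x. x \<in> E \<Longrightarrow> norm x = 1"
    "independent E" "card E = dim {x. \<nu> \<bullet> x = 0}" "span E = {x. \<nu> \<bullet> x = 0}"
    using orthonormal_basis_subspace[OF sub] by blast
  show thesis
    by (rule that[of E])
      (use E dim_hyperplane[OF nz] in
        \<open>auto simp: inner_commute pairwise_def orthogonal_def independent_imp_finite\<close>)
qed

subsection \<open>The distance function and boundary curvature\<close>

definition powr_primitive :: "real \<Rightarrow> real \<Rightarrow> real" where
  "powr_primitive s t = (if s = 2 then ln t else t powr (2 - s) / (2 - s))"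

lemma DERIV_powr_primitive:
  assumes "t > 0"
  shows "(powr_primitive s has_real_derivative t powr (1 - s)) (at t)"
proof (cases "s = 2")
  case True
  then have "powr_primitive s = ln" by (simp add: powr_primitive_def fun_eq_iff)
  then show ?thesis using assms True DERIV_ln_divide[OF assms] by (simp add: powr_minus field_simps)
next
  case False
  then have eq: "powr_primitive s = (\<lambda>t. t powr (2 - s) / (2 - s))"
    by (simp add: powr_primitive_def fun_eq_iff)
  have "((\<lambda>t. t powr (2 - s) / (2 - s)) has_real_derivative (2 - s) * t powr (2 - s - 1) / (2 - s)) (at t)"
    by (intro DERIV_cdivide has_real_derivative_powr assms)
  then show ?thesis unfolding eq using False by simp
qed

lemma powr_primitive_mono:
  assumes "0 < a" "a \<le> b"
  shows "powr_primitive s a \<le> powr_primitive s b"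
proof (cases "a = b")
  case False
  then have "a < b" using assms by simp
  then obtain z where "a < z" "powr_primitive s b - powr_primitive s a = (b - a) * z powr (1 - s)"
    using MVT2[of a b "powr_primitive s" "\<lambda>z. z powr (1 - s)"] DERIV_powr_primitive assms by force
  moreover have "(b - a) * z powr (1 - s) \<ge> 0" using assms by simp
  ultimately show ?thesis by linarith
qed simp

text \<open>For \<open>s \<ge> 1\<close> the derivative \<open>t powr (1 - s)\<close> is
  nonincreasing, so by the mean value theorem the tangent line at \<open>a\<close> stays above the
  graph on both sides.\<close>

lemma powr_primitive_concave:
  assumes "s \<ge> 1" "0 < a" "0 < b"
  shows "powr_primitive s b \<le> powr_primitive s a + a powr (1 - s) * (b - a)"
proof -
  consider "a < b" | "a = b" | "b < a" by linarith
  then show ?thesis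
  proof cases
    case 1
    then obtain z where z: "a < z" "powr_primitive s b - powr_primitive s a = (b - a) * z powr (1 - s)"
      using MVT2[of a b "powr_primitive s" "\<lambda>z. z powr (1 - s)"] DERIV_powr_primitive assms by force
    have "z powr (1 - s) \<le> a powr (1 - s)"
      using z assms by (intro powr_mono2') auto
    then have "(b - a) * z powr (1 - s) \<le> (b - a) * a powr (1 - s)"
      using 1 by (intro mult_left_mono) auto
    then show ?thesis using z by (simp add: mult.commute)
  next
    case 3
    then obtain z where z: "b < z" "z < a" "powr_primitive s a - powr_primitive s b = (a - b) * z powr (1 - s)"
      using MVT2[of b a "powr_primitive s" "\<lambda>z. z powr (1 - s)"] DERIV_powr_primitive assms by force
    have "a powr (1 - s) \<le> z powr (1 - s)"
      using z assms by (intro powr_mono2') auto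
    then have "(a - b) * a powr (1 - s) \<le> (a - b) * z powr (1 - s)"
      using 3 by (intro mult_left_mono) auto
    then show ?thesis using z by (simp add: algebra_simps)
  qed simp
qed

section \<open>Nearest boundary points and semiconcavity\<close>

lemma isCont_tendsto_nhds: "isCont f a \<Longrightarrow> (f \<longlongrightarrow> f a) (nhds a)"
  by (simp only: isCont_def tendsto_at_iff_tendsto_nhds)

text \<open>The complement is closed and nonempty, so the infimum is attained. The ball of that
  radius lies in \<open>\<Omega>\<close>, which puts the attaining point into the closure of
  \<open>\<Omega>\<close> and hence on the frontier.\<close>

lemma nearest_point:
  fixes x :: "'a::euclidean_space"
  assumes "open \<Omega>" "\<Omega> \<noteq> UNIV" "x \<in> \<Omega>"
  obtains y where "y \<in> frontier \<Omega>" "dist x y = infdist x (- \<Omega>)" "infdist x (- \<Omega>) > 0"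
    "ball x (infdist x (- \<Omega>)) \<subseteq> \<Omega>" "y \<notin> \<Omega>"
proof -
  let ?d = "infdist x (- \<Omega>)"
  have cl: "closed (- \<Omega>)" "- \<Omega> \<noteq> {}" using assms by auto
  obtain y where y: "y \<in> - \<Omega>" "?d = dist x y"
    using infdist_attains_inf[OF cl] by blast
  have pos: "?d > 0" using y assms(3) by auto
  have sub: "ball x ?d \<subseteq> \<Omega>"
  proof
    fix z assume "z \<in> ball x ?d"
    then show "z \<in> \<Omega>" using infdist_le[of z "- \<Omega>" x] by (cases "z \<in> \<Omega>") auto
  qed
  have "y \<in> closure (ball x ?d)" using pos y by simp
  then have "y \<in> closure \<Omega>" using sub closure_mono by blast
  then have "y \<in> frontier \<Omega>" using y assms(1) by (simp add: frontier_def interior_open)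
  then show thesis using that pos sub y by auto
qed

text \<open>The distance to one fixed nearest point \<open>y\<close> dominates the distance function
  with equality at \<open>x\<close>, and its second-order term is at most
  \<open>(norm h)\<^sup>2 / (2 * d)\<close>. Concavity of the primitive carries this bound over. The
  margin \<open>2 * \<rho>\<close> keeps \<open>x + h\<close> at positive distance and makes the
  quadratic constant uniform in \<open>x\<close>.\<close>

lemma semiconcave_powr_primitive_infdist:
  fixes x :: "'a::euclidean_space"
  assumes "open \<Omega>" "\<Omega> \<noteq> UNIV" "s \<ge> 1" "\<rho> > 0" and x: "infdist x (- \<Omega>) \<ge> 2 * \<rho>"
  obtains p where "norm p = infdist x (- \<Omega>) powr (1 - s)"
    "\<And>h. norm h \<le> \<rho> \<Longrightarrow> powr_primitive s (infdist (x + h) (- \<Omega>))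
      \<le> powr_primitive s (infdist x (- \<Omega>)) + p \<bullet> h + \<rho> powr (- s) * (norm h)\<^sup>2"
proof -
  let ?d = "infdist x (- \<Omega>)"
  have "x \<in> \<Omega>" using x assms(4) by (cases "x \<in> \<Omega>") auto
  then obtain y where y: "y \<notin> \<Omega>" "dist x y = ?d" "?d > 0"
    using nearest_point[OF assms(1,2)] by metis
  define m where "m = (x - y) /\<^sub>R ?d"
  have m: "x - y = ?d *\<^sub>R m" using y by (simp add: m_def)
  have nm: "norm m = 1" using y by (simp add: m_def dist_norm)
  show thesis
  proof (rule that[of "?d powr (1 - s) *\<^sub>R m"])
    show "norm (?d powr (1 - s) *\<^sub>R m) = ?d powr (1 - s)" by (simp add: nm)
    fix h :: 'a assume h: "norm h \<le> \<rho>"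
    let ?d' = "infdist (x + h) (- \<Omega>)"
    have "?d \<le> ?d' + norm h"
      using infdist_triangle[of x "- \<Omega>" "x + h"] by (simp add: dist_norm)
    then have d': "?d' > 0" using x h assms(4) by linarith
    have "?d' \<le> dist (x + h) y" using y by (intro infdist_le) auto
    also have "\<dots> = norm (?d *\<^sub>R m + h)" by (simp add: dist_norm m[symmetric] algebra_simps)
    also have "\<dots> \<le> ?d + m \<bullet> h + (norm h)\<^sup>2 / (2 * ?d)"
    proof -
      let ?N = "norm (?d *\<^sub>R m + h)"
      have "?N\<^sup>2 = ?d\<^sup>2 + 2 * ?d * (m \<bullet> h) + (norm h)\<^sup>2"
        using nm unfolding power2_norm_eq_inner
        by (simp add: inner_add_left inner_add_right inner_commute norm_eq_1 power2_eq_square)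
      \<comment> \<open>This inequality replaces the expansion of a square root.\<close>
      moreover have "2 * ?d * ?N \<le> ?N\<^sup>2 + ?d\<^sup>2"
        using sum_squares_bound[of ?d ?N] by linarith
      ultimately have "2 * ?d * ?N \<le> 2 * ?d\<^sup>2 + 2 * ?d * (m \<bullet> h) + (norm h)\<^sup>2" by linarith
      then have "?N \<le> (2 * ?d\<^sup>2 + 2 * ?d * (m \<bullet> h) + (norm h)\<^sup>2) / (2 * ?d)"
        using y(3) by (simp add: field_simps)
      also have "\<dots> = ?d + m \<bullet> h + (norm h)\<^sup>2 / (2 * ?d)"
        using y(3) by (simp add: field_simps power2_eq_square)
      finally show ?thesis .
    qed
    finally have le: "?d' - ?d \<le> m \<bullet> h + (norm h)\<^sup>2 / (2 * ?d)" by linarith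
    have "powr_primitive s ?d' \<le> powr_primitive s ?d + ?d powr (1 - s) * (?d' - ?d)"
      using assms(3) y(3) d' by (rule powr_primitive_concave)
    also have "\<dots> \<le> powr_primitive s ?d + ?d powr (1 - s) * (m \<bullet> h + (norm h)\<^sup>2 / (2 * ?d))"
      using le by (intro add_left_mono mult_left_mono) auto
    also have "\<dots> = powr_primitive s ?d + (?d powr (1 - s) *\<^sub>R m) \<bullet> h + ?d powr (- s) / 2 * (norm h)\<^sup>2"
      using y(3) by (simp add: field_simps powr_diff powr_minus)
    also have "?d powr (- s) / 2 * (norm h)\<^sup>2 \<le> \<rho> powr (- s) * (norm h)\<^sup>2"
    proof (rule mult_right_mono)
      have "?d powr (- s) \<le> \<rho> powr (- s)" using assms x by (intro powr_mono2') auto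
      moreover have "?d powr (- s) \<ge> 0" by simp
      ultimately show "?d powr (- s) / 2 \<le> \<rho> powr (- s)" by linarith
    qed simp
    finally show "powr_primitive s ?d'
      \<le> powr_primitive s ?d + (?d powr (1 - s) *\<^sub>R m) \<bullet> h + \<rho> powr (- s) * (norm h)\<^sup>2"
      by simp
  qed
qed

section \<open>Curvature and barriers from local graphs\<close>

lemma deriv_deriv_line:
  fixes \<phi> :: "'a::euclidean_space \<Rightarrow> real"
  assumes "Ck_on 2 (ball 0 \<delta>) \<phi>" "\<delta> > 0"
  shows "deriv (deriv (\<lambda>t. \<phi> (t *\<^sub>R z))) 0 = hess \<phi> z z"
proof -
  obtain f1 r where r: "r > 0"
    and f: "\<And>t. \<bar>t\<bar> < r \<Longrightarrow> ((\<lambda>t. \<phi> (t *\<^sub>R z)) has_real_derivative f1 t) (at t)"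
    and f1: "(f1 has_real_derivative hess \<phi> z z) (at 0)"
    using C2_line_derivatives[OF assms] by blast
  have "(deriv (\<lambda>t. \<phi> (t *\<^sub>R z)) has_real_derivative hess \<phi> z z) (at 0)"
  proof (rule has_field_derivative_transform_within_open[OF f1])
    show "open {- r <..< r}" "0 \<in> {- r <..< r}" using r by auto
    show "f1 t = deriv (\<lambda>t. \<phi> (t *\<^sub>R z)) t" if "t \<in> {- r <..< r}" for t
      using f[of t] that by (auto intro!: DERIV_imp_deriv[symmetric])
  qed
  then show ?thesis by (rule DERIV_imp_deriv)
qed

text \<open>The value picked by \<open>SOME\<close> is realised by some graph and some tangent
  basis. That very graph is handed on, so the barrier built from it has exactly this trace.\<close>

lemma curvature_sum_graph:
  fixes \<Omega> :: "'a::euclidean_space set"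
  assumes "C2_boundary \<Omega>" "y \<in> frontier \<Omega>"
  obtains \<nu> \<delta> \<phi> where "graph_rep \<Omega> y \<nu> \<delta> \<phi>"
    "curvature_sum \<Omega> y = (\<Sum>b\<in>Basis. hess \<phi> (b - (b \<bullet> \<nu>) *\<^sub>R \<nu>) (b - (b \<bullet> \<nu>) *\<^sub>R \<nu>))"
proof -
  let ?P = "\<lambda>c. \<exists>\<nu> \<delta> \<phi> E. graph_rep \<Omega> y \<nu> \<delta> \<phi> \<and>
      finite E \<and> card E = DIM('a) - 1 \<and> (\<forall>e\<in>E. norm e = 1 \<and> e \<bullet> \<nu> = 0) \<and>
      (\<forall>e\<in>E. \<forall>e'\<in>E. e \<noteq> e' \<longrightarrow> e \<bullet> e' = 0) \<and>
      c = (\<Sum>e\<in>E. deriv (deriv (\<lambda>t. \<phi> (t *\<^sub>R e))) 0)"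
  obtain \<nu>0 \<delta>0 \<phi>0 where g0: "graph_rep \<Omega> y \<nu>0 \<delta>0 \<phi>0"
    using assms unfolding C2_boundary_def by blast
  then have "norm \<nu>0 = 1" by (simp add: graph_rep_def)
  then obtain E0 where "finite E0" "card E0 = DIM('a) - 1" "\<And>e. e \<in> E0 \<Longrightarrow> norm e = 1 \<and> e \<bullet> \<nu>0 = 0"
    "\<And>e e'. e \<in> E0 \<Longrightarrow> e' \<in> E0 \<Longrightarrow> e \<noteq> e' \<Longrightarrow> e \<bullet> e' = 0"
    by (rule exists_orthonormal_hyperplane_basis) blast
  \<comment> \<open>The choice in \<open>curvature_sum\<close> is made from a nonempty set.\<close>
  with g0 have "\<exists>c. ?P c" by blast
  then have "?P (SOME c. ?P c)" by (rule someI_ex)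
  then have "?P (curvature_sum \<Omega> y)" by (simp only: curvature_sum_def)
  then obtain \<nu> \<delta> \<phi> E where g: "graph_rep \<Omega> y \<nu> \<delta> \<phi>"
    and E: "finite E" "card E = DIM('a) - 1" "\<And>e. e \<in> E \<Longrightarrow> norm e = 1" "\<And>e. e \<in> E \<Longrightarrow> e \<bullet> \<nu> = 0"
      "\<And>e e'. e \<in> E \<Longrightarrow> e' \<in> E \<Longrightarrow> e \<noteq> e' \<Longrightarrow> e \<bullet> e' = 0"
    and c: "curvature_sum \<Omega> y = (\<Sum>e\<in>E. deriv (deriv (\<lambda>t. \<phi> (t *\<^sub>R e))) 0)"
    by blast
  have gg: "norm \<nu> = 1" "\<delta> > 0" "Ck_on 2 (ball 0 \<delta>) \<phi>" using g unfolding graph_rep_def by blast+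
  have "curvature_sum \<Omega> y = (\<Sum>e\<in>E. hess \<phi> e e)"
    unfolding c deriv_deriv_line[OF gg(3,2)] ..
  also have "\<dots> = (\<Sum>b\<in>Basis. hess \<phi> (b - (b \<bullet> \<nu>) *\<^sub>R \<nu>) (b - (b \<bullet> \<nu>) *\<^sub>R \<nu>))"
    by (rule trace_orthonormal_hyperplane[OF bilinear_hess E gg(1), symmetric])
  finally show thesis using that g by blast
qed

text \<open>A ball inside \<open>\<Omega>\<close> that touches the graph at \<open>y\<close> must
  have its centre on the inner normal, since the graph is flat to first order at
  \<open>y\<close>.\<close>

lemma graph_rep_normal:
  fixes \<Omega> :: "'a::euclidean_space set"
  assumes g: "graph_rep \<Omega> y \<nu> \<delta> \<phi>" and d: "ball x d \<subseteq> \<Omega>" "dist x y = d" "d > 0"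
  shows "x = y + d *\<^sub>R \<nu>"
proof -
  define m where "m = (x - y) /\<^sub>R d"
  have m: "x - y = d *\<^sub>R m" using d by (simp add: m_def)
  have nm: "norm m = 1" using d by (simp add: m_def dist_norm)
  have n\<nu>: "norm \<nu> = 1" and \<delta>: "\<delta> > 0" and \<phi>0: "\<phi> 0 = 0" using g by (auto simp: graph_rep_def)
  \<comment> \<open>If \<open>k\<close> points strictly into the ball, then
    \<open>y + t *\<^sub>R k\<close> lies in \<open>\<Omega>\<close> for small \<open>t > 0\<close>,
    so \<open>\<phi> (t *\<^sub>R P) < t * (k \<bullet> \<nu>)\<close>. Dividing by \<open>t\<close>
    and letting it tend to 0 gives the claim.\<close>
  have key: "k \<bullet> \<nu> \<ge> 0" if k: "k \<bullet> m > 0" for k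
  proof -
    define P where "P = k - (k \<bullet> \<nu>) *\<^sub>R \<nu>"
    have P\<nu>: "P \<bullet> \<nu> = 0" using n\<nu> by (simp add: P_def inner_diff_left norm_eq_1)
    then have der: "((\<lambda>t. \<phi> (t *\<^sub>R P)) has_real_derivative 0) (at 0)"
      using g by (auto simp: graph_rep_def)
    have "((\<lambda>t. (\<phi> (t *\<^sub>R P)) / t) \<longlongrightarrow> 0) (at_right 0)"
      using der \<phi>0 unfolding DERIV_def by (simp add: filterlim_at_split)
    moreover have "eventually (\<lambda>t. (\<phi> (t *\<^sub>R P)) / t \<le> k \<bullet> \<nu>) (at_right 0)"
    proof -
      have e1: "eventually (\<lambda>t. norm (t *\<^sub>R P) < \<delta>) (at_right 0)"
        by (rule order_tendstoD[of _ "norm (0 *\<^sub>R P)"]) (auto intro!: tendsto_eq_intros \<delta>)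
      have e2: "eventually (\<lambda>t. \<bar>t * (k \<bullet> \<nu>)\<bar> < \<delta>) (at_right 0)"
        by (rule order_tendstoD[of _ "\<bar>0 * (k \<bullet> \<nu>)\<bar>"]) (auto intro!: tendsto_eq_intros \<delta>)
      \<comment> \<open>For \<open>t > 0\<close> this is exactly the condition that
        \<open>y + t *\<^sub>R k\<close> lies in the ball, as the expansion of the squared norm
        below shows.\<close>
      have e3: "eventually (\<lambda>t. t * (norm k)\<^sup>2 < 2 * d * (k \<bullet> m)) (at_right 0)"
        by (rule order_tendstoD[of _ "0 * (norm k)\<^sup>2"]) (use d k in \<open>auto intro!: tendsto_eq_intros\<close>)
      have e4: "eventually (\<lambda>t::real. t > 0) (at_right 0)" by (simp add: eventually_at_right_less)
      show ?thesis
        using e1 e2 e3 e4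
      proof eventually_elim
        case (elim t)
        have "(norm (y + t *\<^sub>R k - x))\<^sup>2 = (norm (t *\<^sub>R k - d *\<^sub>R m))\<^sup>2"
          by (simp add: m[symmetric] algebra_simps)
        also have "\<dots> = d\<^sup>2 - t * (2 * d * (k \<bullet> m) - t * (norm k)\<^sup>2)"
          using nm unfolding power2_norm_eq_inner
          by (simp add: inner_diff_left inner_diff_right inner_commute norm_eq_1 algebra_simps
              power2_eq_square)
        also have "\<dots> < d\<^sup>2" using elim by simp
        finally have "norm (y + t *\<^sub>R k - x) < d" using d(3) by (simp add: power_less_imp_less_base)
        then have "y + t *\<^sub>R k \<in> \<Omega>" using d(1) by (auto simp: dist_norm norm_minus_commute)
        moreover have "y + t *\<^sub>R k = y + t *\<^sub>R P + (t * (k \<bullet> \<nu>)) *\<^sub>R \<nu>"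
          by (simp add: P_def algebra_simps)
        ultimately have "\<phi> (t *\<^sub>R P) < t * (k \<bullet> \<nu>)"
          using g elim P\<nu> unfolding graph_rep_def by (metis inner_scaleR_left mult_zero_right)
        then show ?case using elim by (simp add: field_simps)
      qed
    qed
    ultimately show ?thesis by (intro tendsto_upperbound) auto
  qed
  \<comment> \<open>Otherwise \<open>m - \<nu>\<close> has positive inner product with
    \<open>m\<close> and negative inner product with \<open>\<nu>\<close>, contradicting
    \<open>key\<close>.\<close>
  have "m = \<nu>"
  proof (rule ccontr)
    assume "m \<noteq> \<nu>"
    then have "0 < (m - \<nu>) \<bullet> (m - \<nu>)" by simp
    then have "m \<bullet> \<nu> < 1"
      using nm n\<nu> by (simp add: inner_diff_left inner_diff_right inner_commute norm_eq_1)
    then show False using key[of "m - \<nu>"] nm n\<nu>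
      by (simp add: inner_diff_left inner_diff_right inner_commute norm_eq_1)
  qed
  then show ?thesis using m by (simp add: algebra_simps)
qed

text \<open>The vertical gap to the graph point with the same tangential coordinate bounds the
  distance. The bound holds on a two-sided neighbourhood of 0 because second differences use both
  \<open>e\<close> and \<open>- e\<close>.\<close>

lemma graph_rep_infdist_le:
  fixes \<Omega> :: "'a::euclidean_space set"
  assumes g: "graph_rep \<Omega> y \<nu> \<delta> \<phi>" and "d > 0"
  shows "\<forall>\<^sub>F t in nhds 0. infdist (y + d *\<^sub>R \<nu> + t *\<^sub>R b) (- \<Omega>)
      \<le> d + t * (b \<bullet> \<nu>) - \<phi> (t *\<^sub>R (b - (b \<bullet> \<nu>) *\<^sub>R \<nu>))"
proof -
  define P where "P = b - (b \<bullet> \<nu>) *\<^sub>R \<nu>"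
  have n\<nu>: "norm \<nu> = 1" and \<delta>: "\<delta> > 0" and \<phi>0: "\<phi> 0 = 0"
    and C: "continuous_on (ball 0 \<delta>) \<phi>" using g by (auto simp: graph_rep_def numeral_2_eq_2)
  have P\<nu>: "P \<bullet> \<nu> = 0" using n\<nu> by (simp add: P_def inner_diff_left norm_eq_1)
  have "isCont \<phi> (0 *\<^sub>R P)" using C \<delta> by (simp add: continuous_on_eq_continuous_at)
  then have lim: "((\<lambda>t. \<phi> (t *\<^sub>R P)) \<longlongrightarrow> \<phi> (0 *\<^sub>R P)) (nhds 0)"
    by (rule isCont_tendsto_compose) (auto intro!: tendsto_eq_intros filterlim_ident)
  have id: "((\<lambda>t::real. t) \<longlongrightarrow> 0) (nhds 0)" by (rule filterlim_ident)
  have e1: "\<forall>\<^sub>F t in nhds 0. norm (t *\<^sub>R P) < \<delta>"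
    by (rule order_tendstoD[of _ "norm (0 *\<^sub>R P)"]) (auto intro!: tendsto_eq_intros id \<delta>)
  have e2: "\<forall>\<^sub>F t in nhds 0. \<bar>\<phi> (t *\<^sub>R P)\<bar> < \<delta>"
    by (rule order_tendstoD[OF tendsto_rabs[OF lim]]) (simp add: \<phi>0 \<delta>)
  have e3: "\<forall>\<^sub>F t in nhds 0. 0 < d + t * (b \<bullet> \<nu>) - \<phi> (t *\<^sub>R P)"
    by (rule order_tendstoD(1)[OF tendsto_diff[OF tendsto_add[OF tendsto_const
            tendsto_mult[OF id tendsto_const]] lim]]) (use \<open>d > 0\<close> \<phi>0 in simp)
  show ?thesis
    unfolding P_def[symmetric] using e1 e2 e3
  proof eventually_elim
    case (elim t)
    \<comment> \<open>The inequality \<open>\<phi> z < t\<close> in \<open>graph_rep\<close> is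
      strict, so points of the graph itself are outside \<open>\<Omega>\<close>.\<close>
    let ?q = "y + t *\<^sub>R P + \<phi> (t *\<^sub>R P) *\<^sub>R \<nu>"
    have "?q \<notin> \<Omega>"
      using g elim P\<nu> unfolding graph_rep_def by (metis inner_scaleR_left mult_zero_right less_irrefl)
    then have "infdist (y + d *\<^sub>R \<nu> + t *\<^sub>R b) (- \<Omega>) \<le> dist (y + d *\<^sub>R \<nu> + t *\<^sub>R b) ?q"
      by (intro infdist_le) auto
    also have "\<dots> = norm ((d + t * (b \<bullet> \<nu>) - \<phi> (t *\<^sub>R P)) *\<^sub>R \<nu>)"
      unfolding dist_norm by (rule arg_cong[of _ _ norm]) (simp add: P_def algebra_simps)
    also have "\<dots> = d + t * (b \<bullet> \<nu>) - \<phi> (t *\<^sub>R P)" using elim n\<nu> by simp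
    finally show ?case .
  qed
qed

text \<open>The chain rule gives the derivative \<open>F1\<close> near 0. In its product-rule
  derivative at 0 the condition \<open>f1 0 = 0\<close> removes the first-order part of
  \<open>f\<close>, so only \<open>\<beta>\<close> and \<open>H\<close> survive.\<close>

lemma powr_primitive_second_difference:
  fixes f :: "real \<Rightarrow> real" and s \<beta> :: real
  assumes "r > 0" and f: "\<And>t. \<bar>t\<bar> < r \<Longrightarrow> (f has_real_derivative f1 t) (at t)"
    and f1: "(f1 has_real_derivative H) (at 0)" and 0: "f 0 = 0" "f1 0 = 0" and "d > 0"
  defines "F \<equiv> \<lambda>t. powr_primitive s (d + t * \<beta> - f t)"
  shows "((\<lambda>e. (F e + F (- e) - 2 * F 0) / e\<^sup>2) \<longlongrightarrow> (1 - s) * d powr (- s) * \<beta>\<^sup>2 - d powr (1 - s) * H) (at_right 0)"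
proof -
  let ?a = "\<lambda>t. d + t * \<beta> - f t"
  have "isCont f 0" using f[of 0] \<open>r > 0\<close> by (auto intro: DERIV_isCont)
  then have "isCont ?a 0" by (intro continuous_intros)
  then have "\<forall>\<^sub>F t in nhds 0. ?a t > 0"
    by (rule order_tendstoD[OF isCont_tendsto_nhds]) (use \<open>d > 0\<close> 0 in simp)
  then obtain r' where r': "r' > 0" "\<And>t. \<bar>t\<bar> < r' \<Longrightarrow> ?a t > 0"
    unfolding eventually_nhds_metric by (auto simp: dist_real_def)
  have da: "(?a has_real_derivative \<beta> - f1 t) (at t)" if "\<bar>t\<bar> < r" for t
    using f[OF that] by (auto intro!: derivative_eq_intros)
  define F1 where "F1 t = ?a t powr (1 - s) * (\<beta> - f1 t)" for t
  show ?thesis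
  proof (rule second_difference_tendsto)
    show "min r r' > 0" using assms r' by simp
    show "(F has_real_derivative F1 t) (at t)" if "\<bar>t\<bar> < min r r'" for t
      unfolding F_def F1_def using that r'
      by (intro DERIV_chain2[OF DERIV_powr_primitive] da) auto
    have "((\<lambda>t. ?a t powr (1 - s)) has_real_derivative ((1 - s) * ?a 0 powr (1 - s - 1)) * (\<beta> - f1 0)) (at 0)"
      using \<open>d > 0\<close> 0 \<open>r > 0\<close> by (intro DERIV_chain2[OF has_real_derivative_powr] da) auto
    from DERIV_mult[OF this DERIV_diff[OF DERIV_const f1]]
    show "(F1 has_real_derivative (1 - s) * d powr (- s) * \<beta>\<^sup>2 - d powr (1 - s) * H) (at 0)"
      unfolding F1_def[abs_def] using 0 by (simp add: power2_eq_square algebra_simps)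
  qed
qed

text \<open>The barriers \<open>F b\<close> lie above \<open>w\<close> along each axis and agree
  with it at \<open>x\<close>, so their second differences dominate. Only an upper bound is claimed,
  as \<open>w\<close> may have a kink at \<open>x\<close>; the slack \<open>\<eta>\<close> turns the
  limit for the barriers into an eventual strict inequality.\<close>

lemma second_difference_infdist_le:
  fixes \<Omega> :: "'a::euclidean_space set" and s :: real
  assumes "open \<Omega>" "\<Omega> \<noteq> UNIV" "C2_boundary \<Omega>" "x \<in> \<Omega>"
    and curv: "\<And>y. y \<in> frontier \<Omega> \<Longrightarrow> l \<le> curvature_sum \<Omega> y" and "\<eta> > 0"
  defines "w \<equiv> \<lambda>x. powr_primitive s (infdist x (- \<Omega>))"
  shows "\<forall>\<^sub>F e in at_right 0. (\<Sum>b\<in>Basis. (w (x + e *\<^sub>R b) + w (x - e *\<^sub>R b) - 2 * w x) / e\<^sup>2)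
      < (1 - s) * infdist x (- \<Omega>) powr (- s) - l * infdist x (- \<Omega>) powr (1 - s) + \<eta>"
proof -
  define d where "d = infdist x (- \<Omega>)"
  obtain y where y: "y \<in> frontier \<Omega>" "dist x y = d" "d > 0" "ball x d \<subseteq> \<Omega>"
    using nearest_point[OF assms(1,2,4)] by (metis d_def)
  obtain \<nu> \<delta> \<phi> where g: "graph_rep \<Omega> y \<nu> \<delta> \<phi>"
    and c: "curvature_sum \<Omega> y = (\<Sum>b\<in>Basis. hess \<phi> (b - (b \<bullet> \<nu>) *\<^sub>R \<nu>) (b - (b \<bullet> \<nu>) *\<^sub>R \<nu>))"
    using curvature_sum_graph[OF assms(3) y(1)] by metis
  have n\<nu>: "norm \<nu> = 1" and \<delta>: "\<delta> > 0" and \<phi>0: "\<phi> 0 = 0" and C: "Ck_on 2 (ball 0 \<delta>) \<phi>"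
    using g unfolding graph_rep_def by blast+
  have x: "x = y + d *\<^sub>R \<nu>" using graph_rep_normal[OF g y(4,2,3)] .
  define P where "P b = b - (b \<bullet> \<nu>) *\<^sub>R \<nu>" for b
  define F where "F b t = powr_primitive s (d + t * (b \<bullet> \<nu>) - \<phi> (t *\<^sub>R P b))" for b t
  have P\<nu>: "P b \<bullet> \<nu> = 0" for b using n\<nu> by (simp add: P_def inner_diff_left norm_eq_1)
  have lim: "((\<lambda>e. (F b e + F b (- e) - 2 * F b 0) / e\<^sup>2) \<longlongrightarrow>
      (1 - s) * d powr (- s) * (b \<bullet> \<nu>)\<^sup>2 - d powr (1 - s) * hess \<phi> (P b) (P b)) (at_right 0)" for b
  proof -
    obtain f1 r where r: "r > 0"
      and f: "\<And>t. \<bar>t\<bar> < r \<Longrightarrow> ((\<lambda>t. \<phi> (t *\<^sub>R P b)) has_real_derivative f1 t) (at t)"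
      and f1: "(f1 has_real_derivative hess \<phi> (P b) (P b)) (at 0)"
      using C2_line_derivatives[OF C \<delta>] by blast
    have "((\<lambda>t. \<phi> (t *\<^sub>R P b)) has_real_derivative 0) (at 0)"
      using g P\<nu> by (auto simp: graph_rep_def)
    then have "f1 0 = 0" using f[of 0] r DERIV_unique by force
    with powr_primitive_second_difference[OF r f f1 _ _ y(3), where s = s and \<beta> = "b \<bullet> \<nu>"]
    show ?thesis by (simp add: F_def \<phi>0)
  qed
  have "((\<lambda>e. \<Sum>b\<in>Basis. (F b e + F b (- e) - 2 * F b 0) / e\<^sup>2) \<longlongrightarrow>
      (\<Sum>b\<in>Basis. (1 - s) * d powr (- s) * (b \<bullet> \<nu>)\<^sup>2 - d powr (1 - s) * hess \<phi> (P b) (P b))) (at_right 0)"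
    by (intro tendsto_sum lim)
  moreover have "(\<Sum>b\<in>Basis. (1 - s) * d powr (- s) * (b \<bullet> \<nu>)\<^sup>2 - d powr (1 - s) * hess \<phi> (P b) (P b))
      = (1 - s) * d powr (- s) - d powr (1 - s) * curvature_sum \<Omega> y"
  proof -
    \<comment> \<open>The normal direction thus contributes the singular term exactly once; the
      tangential parts sum to the curvature.\<close>
    have "(\<Sum>b\<in>Basis. (b \<bullet> \<nu>)\<^sup>2) = 1"
      using n\<nu> by (simp add: norm_eq_1 euclidean_inner[of \<nu> \<nu>] power2_eq_square inner_commute)
    then show ?thesis
      by (simp add: c P_def[symmetric] sum_subtractf sum_distrib_left[symmetric])
  qed
  moreover have "d powr (1 - s) * curvature_sum \<Omega> y \<ge> d powr (1 - s) * l"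
    using curv[OF y(1)] by (intro mult_left_mono) auto
  ultimately have ev: "\<forall>\<^sub>F e in at_right 0. (\<Sum>b\<in>Basis. (F b e + F b (- e) - 2 * F b 0) / e\<^sup>2)
      < (1 - s) * d powr (- s) - l * d powr (1 - s) + \<eta>"
    using \<open>\<eta> > 0\<close> by (intro order_tendstoD(2)) (auto simp: mult.commute)
  have le: "\<forall>\<^sub>F t in nhds 0. w (x + t *\<^sub>R b) \<le> F b t" for b
  proof -
    have "isCont (\<lambda>t. infdist (x + t *\<^sub>R b) (- \<Omega>)) 0"
      by (intro continuous_intros)
    then have "\<forall>\<^sub>F t in nhds 0. infdist (x + t *\<^sub>R b) (- \<Omega>) > 0"
      by (rule order_tendstoD[OF isCont_tendsto_nhds]) (use y(3) d_def in simp)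
    with graph_rep_infdist_le[OF g y(3), of b] show ?thesis
      unfolding x[symmetric] P_def[symmetric]
      by eventually_elim (auto simp: w_def F_def intro: powr_primitive_mono)
  qed
  have le': "\<forall>\<^sub>F e in at_right 0. w (x + e *\<^sub>R b) \<le> F b e \<and> w (x - e *\<^sub>R b) \<le> F b (- e)" for b
  proof -
    obtain r where r: "r > 0" "\<And>t. \<bar>t\<bar> < r \<Longrightarrow> w (x + t *\<^sub>R b) \<le> F b t"
      using le[of b] unfolding eventually_nhds_metric by (auto simp: dist_real_def)
    show ?thesis unfolding eventually_at_right_field
      using r(1) r(2)[of "- t" for t] r(2) by (intro exI[of _ r]) auto
  qed
  have "\<forall>\<^sub>F e in at_right 0. \<forall>b\<in>Basis. w (x + e *\<^sub>R b) \<le> F b e \<and> w (x - e *\<^sub>R b) \<le> F b (- e)"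
    using le' by (intro eventually_ball_finite) auto
  with ev show ?thesis
  proof eventually_elim
    case (elim e)
    \<comment> \<open>Contact at \<open>x\<close> is what makes the negative term
      \<open>- 2 * w x\<close> match.\<close>
    have F0: "F b 0 = w x" for b by (simp add: F_def w_def \<phi>0 d_def)
    have "(\<Sum>b\<in>Basis. (w (x + e *\<^sub>R b) + w (x - e *\<^sub>R b) - 2 * w x) / e\<^sup>2)
        \<le> (\<Sum>b\<in>Basis. (F b e + F b (- e) - 2 * F b 0) / e\<^sup>2)"
      using elim(2) unfolding F0 by (intro sum_mono divide_right_mono) (auto intro!: add_mono)
    then show ?case using elim(1) by (simp add: d_def)
  qed
qed

subsection \<open>Integrated second differences\<close>

lemma lborel_integral_translate:
  fixes f :: "'a::euclidean_space \<Rightarrow> real"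
  assumes "f \<in> borel_measurable borel"
  shows "(LINT x|lborel. f (x + a)) = (LINT x|lborel. f x)"
proof -
  have "(LINT x|lborel. f x) = (LINT x|distr lborel borel ((+) a). f x)"
    by (simp only: lborel_distr_plus)
  also have "\<dots> = (LINT x|lborel. f (a + x))"
    by (rule integral_distr) (use assms in auto)
  finally show ?thesis by (simp add: add.commute)
qed

lemma integrable_lborel_compact_support:
  fixes f :: "'a::euclidean_space \<Rightarrow> real"
  assumes "continuous_on UNIV f" "compact K" "\<And>x. x \<notin> K \<Longrightarrow> f x = 0"
  shows "integrable lborel f"
proof -
  have "(\<lambda>x. indicator K x *\<^sub>R f x) = f"
    using assms(3) by (fastforce simp: fun_eq_iff indicator_def)
  then show ?thesis
    using borel_integrable_compact[OF assms(2) continuous_on_subset[OF assms(1)]] by simp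
qed

lemma integral_pos_continuous:
  fixes f :: "'a::euclidean_space \<Rightarrow> real"
  assumes "continuous_on UNIV f" "integrable lborel f" "\<And>x. f x \<ge> 0" "f x0 > 0"
  shows "(LINT x|lborel. f x) > 0"
proof (rule ccontr)
  assume "\<not> ?thesis"
  then have "(LINT x|lborel. f x) = 0"
    using Bochner_Integration.integral_nonneg[of lborel f, OF assms(3)] by simp
  then have "AE x in lborel. f x = 0"
    using integral_nonneg_eq_0_iff_AE[OF assms(2)] assms(3) by simp
  moreover have op: "open {x. f x \<noteq> 0}"
    using open_Collect_neq[OF assms(1) continuous_on_const] .
  ultimately have "{x. f x \<noteq> 0} \<in> null_sets lborel"
    by (subst (asm) AE_iff_null) auto
  then have "negligible {x. f x \<noteq> 0}"
    by (simp add: negligible_iff_null_sets null_sets_completionI)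
  then show False using open_not_negligible[OF op] assms(4) by force
qed

text \<open>A summation by parts in which the increments of the weight appear only where they are
  positive. Upper bounds on the increments of \<open>w\<close>, as provided by semiconcavity, therefore
  suffice to estimate the right-hand side.\<close>
lemma second_difference_by_parts:
  fixes \<phi> w :: "'a::euclidean_space \<Rightarrow> real"
  assumes \<phi>: "continuous_on UNIV \<phi>" and w: "continuous_on UNIV w"
    and K: "compact K" "\<And>x. x \<notin> K \<Longrightarrow> \<phi> x = 0"
  shows "integrable lborel (\<lambda>x. max 0 (\<phi> (x + h) - \<phi> x) * (w (x + h) - w x)
      + max 0 (\<phi> (x - h) - \<phi> x) * (w (x - h) - w x))"
    and "- (LINT x|lborel. \<phi> x * (w (x + h) + w (x - h) - 2 * w x))
      = (LINT x|lborel. max 0 (\<phi> (x + h) - \<phi> x) * (w (x + h) - w x)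
      + max 0 (\<phi> (x - h) - \<phi> x) * (w (x - h) - w x))"
proof -
  \<comment> \<open>One compact set containing \<open>K\<close> and both of its translates supports
    all the integrands below.\<close>
  define S where "S = K \<union> (\<lambda>x. - h + x) ` K \<union> (\<lambda>x. h + x) ` K"
  have S: "compact S" unfolding S_def by (intro compact_Un compact_translation K)
  have inS: "x \<in> S" if "x \<in> K \<or> x + h \<in> K \<or> x - h \<in> K" for x
  proof -
    have "x = - h + (x + h)" "x = h + (x - h)" by auto
    with that show ?thesis unfolding S_def by blast
  qed
  note [continuous_intros] = continuous_on_compose2[OF \<phi> _ subset_UNIV]
    continuous_on_compose2[OF w _ subset_UNIV]
  have out: "\<phi> x = 0" "\<phi> (x + h) = 0" "\<phi> (x - h) = 0" if "x \<notin> S" for x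
    using inS[of x] that K(2) by blast+
  have I: "integrable lborel f" if "continuous_on UNIV f" "\<And>x. x \<notin> S \<Longrightarrow> f x = 0" for f :: "'a \<Rightarrow> real"
    using that by (intro integrable_lborel_compact_support[OF _ S]) auto
  have meas: "f \<in> borel_measurable borel" if "continuous_on UNIV f" for f :: "'a \<Rightarrow> real"
    using that by (rule borel_measurable_continuous_onI)
  let ?f1 = "\<lambda>x. \<phi> x * (w (x + h) - w x)"
  let ?f2 = "\<lambda>x. \<phi> x * (w x - w (x - h))"
  let ?f3 = "\<lambda>x. \<phi> (x + h) * (w (x + h) - w x)"
  let ?p = "\<lambda>x. max 0 (\<phi> (x + h) - \<phi> x) * (w (x + h) - w x)"
  let ?m = "\<lambda>x. max 0 (\<phi> x - \<phi> (x + h)) * (w (x + h) - w x)"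
  let ?m' = "\<lambda>x. max 0 (\<phi> (x - h) - \<phi> x) * (w x - w (x - h))"
  have c: "continuous_on UNIV ?f1" "continuous_on UNIV ?f2" "continuous_on UNIV ?f3"
    "continuous_on UNIV ?p" "continuous_on UNIV ?m" "continuous_on UNIV ?m'"
    by (intro continuous_intros; simp)+
  have i: "integrable lborel ?f1" "integrable lborel ?f2" "integrable lborel ?f3"
    "integrable lborel ?p" "integrable lborel ?m" "integrable lborel ?m'"
    by (intro I c; simp add: out)+
  have e: "(\<lambda>x. max 0 (\<phi> (x + h) - \<phi> x) * (w (x + h) - w x)
      + max 0 (\<phi> (x - h) - \<phi> x) * (w (x - h) - w x)) = (\<lambda>x. ?p x - ?m' x)"
    by (simp add: fun_eq_iff algebra_simps)
  show "integrable lborel (\<lambda>x. max 0 (\<phi> (x + h) - \<phi> x) * (w (x + h) - w x)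
      + max 0 (\<phi> (x - h) - \<phi> x) * (w (x - h) - w x))"
    unfolding e using i by (intro Bochner_Integration.integrable_diff)
  have t1: "(LINT x|lborel. ?f2 x) = (LINT x|lborel. ?f3 x)"
    using lborel_integral_translate[OF meas[OF c(2)], of h] by simp
  \<comment> \<open>Translation by \<open>- h\<close> turns a decrease of \<open>\<phi>\<close>
    along \<open>h\<close> into an increase along \<open>- h\<close>.\<close>
  have t2: "(LINT x|lborel. ?m x) = (LINT x|lborel. ?m' x)"
    using lborel_integral_translate[OF meas[OF c(5)], of "- h"] by simp
  have "- (LINT x|lborel. \<phi> x * (w (x + h) + w (x - h) - 2 * w x)) = - (LINT x|lborel. ?f1 x - ?f2 x)"
    by (simp add: algebra_simps)
  also have "\<dots> = (LINT x|lborel. ?f3 x) - (LINT x|lborel. ?f1 x)"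
    using i t1 by simp
  also have "\<dots> = (LINT x|lborel. ?f3 x - ?f1 x)" using i by simp
  also have "\<dots> = (LINT x|lborel. ?p x - ?m x)"
    by (intro Bochner_Integration.integral_cong) (auto simp: max_def algebra_simps)
  also have "\<dots> = (LINT x|lborel. ?p x - ?m' x)"
    using i t2 by simp
  finally show "- (LINT x|lborel. \<phi> x * (w (x + h) + w (x - h) - 2 * w x))
      = (LINT x|lborel. max 0 (\<phi> (x + h) - \<phi> x) * (w (x + h) - w x)
      + max 0 (\<phi> (x - h) - \<phi> x) * (w (x - h) - w x))"
    unfolding e .
qed

text \<open>The one-sided bound \<open>C\<close> makes \<open>\<phi> x * (C - L k x)\<close>
  nonnegative, so Fatou's lemma applies to it; the hypothesis \<open>lim\<close> says that the upper
  limit of \<open>L k x\<close> is at most \<open>- \<Lambda> x\<close>.\<close>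

lemma fatou_weighted_upper:
  fixes \<phi> \<Lambda> :: "'a \<Rightarrow> real" and L :: "nat \<Rightarrow> 'a \<Rightarrow> real"
  assumes int: "integrable M \<phi>" "integrable M (\<lambda>x. \<phi> x * \<Lambda> x)" "\<And>k. integrable M (\<lambda>x. \<phi> x * L k x)"
    and pos: "\<And>x. \<phi> x \<ge> 0"
    and bound: "\<And>k x. \<phi> x \<noteq> 0 \<Longrightarrow> L k x \<le> C"
    and lim: "\<And>x \<eta>. \<phi> x \<noteq> 0 \<Longrightarrow> \<eta> > 0 \<Longrightarrow> \<forall>\<^sub>F k in sequentially. L k x < - \<Lambda> x + \<eta>"
    and I: "\<And>\<epsilon>. \<epsilon> > 0 \<Longrightarrow> \<forall>\<^sub>F k in sequentially. - (\<integral>x. \<phi> x * L k x \<partial>M) \<le> I + \<epsilon>"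
  shows "(\<integral>x. \<phi> x * \<Lambda> x \<partial>M) \<le> I"
proof (rule field_le_epsilon)
  fix \<epsilon> :: real assume "\<epsilon> > 0"
  define f where "f k x = \<phi> x * (C - L k x)" for k x
  define g where "g x = \<phi> x * (C + \<Lambda> x)" for x
  have f0: "f k x \<ge> 0" for k x
    using bound[of x k] pos[of x] by (cases "\<phi> x = 0") (auto simp: f_def)
  have f_alt: "f k = (\<lambda>x. C * \<phi> x - \<phi> x * L k x)" for k by (simp add: f_def fun_eq_iff algebra_simps)
  have g_alt: "g = (\<lambda>x. C * \<phi> x + \<phi> x * \<Lambda> x)" by (simp add: g_def fun_eq_iff algebra_simps)
  have fi: "integrable M (f k)" for k unfolding f_alt using int by auto
  have gi: "integrable M g" unfolding g_alt using int by auto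
  have If: "(\<integral>x. f k x \<partial>M) = C * (\<integral>x. \<phi> x \<partial>M) - (\<integral>x. \<phi> x * L k x \<partial>M)" for k
    unfolding f_alt using int by simp
  have Ig: "(\<integral>x. g x \<partial>M) = C * (\<integral>x. \<phi> x \<partial>M) + (\<integral>x. \<phi> x * \<Lambda> x \<partial>M)"
    unfolding g_alt using int by simp
  define r where "r = C * (\<integral>x. \<phi> x \<partial>M) + (I + \<epsilon>)"
  have ev: "\<forall>\<^sub>F k in sequentially. (\<integral>x. f k x \<partial>M) \<le> r"
    using I[OF \<open>\<epsilon> > 0\<close>] by eventually_elim (simp add: If r_def)
  \<comment> \<open>Nonnegativity lets the bound return from \<open>ennreal\<close> to the reals
    without truncation.\<close>
  have r0: "r \<ge> 0"
  proof -
    obtain k where "(\<integral>x. f k x \<partial>M) \<le> r" using ev eventually_sequentially by auto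
    then show ?thesis using Bochner_Integration.integral_nonneg[of M "f k", OF f0] by simp
  qed
  \<comment> \<open>Where \<open>g\<close> is negative, \<open>ennreal\<close> replaces it by 0.
    This can only enlarge the integral, so the final upper bound for \<open>g\<close> is still
    valid.\<close>
  have "(\<integral>\<^sup>+x. ennreal (g x) \<partial>M) \<le> (\<integral>\<^sup>+x. liminf (\<lambda>k. ennreal (f k x)) \<partial>M)"
  proof (rule nn_integral_mono)
    fix x
    show "ennreal (g x) \<le> liminf (\<lambda>k. ennreal (f k x))"
    proof (cases "\<phi> x = 0")
      case True then show ?thesis by (simp add: g_def)
    next
      case False
      then have p: "\<phi> x > 0" using pos[of x] by simp
      show ?thesis unfolding le_Liminf_iff
      proof (intro allI impI)
        fix y assume y: "y < ennreal (g x)"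
        then obtain y' where y': "y = ennreal y'" "y' \<ge> 0"
          by (cases y) auto
        then have lt: "y' < g x" using y by (simp add: ennreal_less_iff)
        \<comment> \<open>Scaled so that \<open>\<phi> x * \<eta>\<close> is the whole gap between
          \<open>g x\<close> and \<open>y'\<close>.\<close>
        define \<eta> where "\<eta> = (g x - y') / \<phi> x"
        have "\<eta> > 0" using lt p by (simp add: \<eta>_def)
        from lim[OF False this]
        show "\<forall>\<^sub>F k in sequentially. y < ennreal (f k x)"
        proof eventually_elim
          case (elim k)
          have "\<phi> x * L k x < \<phi> x * (- \<Lambda> x + \<eta>)" using elim p by simp
          moreover have "\<phi> x * \<eta> = g x - y'" using p by (simp add: \<eta>_def)
          ultimately have "y' < f k x" unfolding f_def g_def by (simp add: algebra_simps)
          then show ?case using y' by (simp add: ennreal_less_iff)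
        qed
      qed
    qed
  qed
  also have "\<dots> \<le> liminf (\<lambda>k. \<integral>\<^sup>+x. ennreal (f k x) \<partial>M)"
    using fi by (intro nn_integral_liminf) auto
  also have "\<dots> = liminf (\<lambda>k. ennreal (\<integral>x. f k x \<partial>M))"
    using fi f0 by (simp add: nn_integral_eq_integral)
  also have "\<dots> \<le> liminf (\<lambda>k. ennreal r)"
    by (rule Liminf_mono) (use ev in \<open>eventually_elim, simp add: ennreal_leI\<close>)
  also have "\<dots> = ennreal r" by (simp add: Liminf_const)
  finally have "(\<integral>x. g x \<partial>M) \<le> r" by (rule integral_real_bounded[OF r0])
  then show "(\<integral>x. \<phi> x * \<Lambda> x \<partial>M) \<le> I + \<epsilon>" by (simp add: Ig r_def)
qed

section \<open>Test functions and their increments\<close>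

lemma continuous_on_UNIV_extend_zero:
  assumes "open \<Omega>" "closed K" "K \<subseteq> \<Omega>" "continuous_on \<Omega> f" "\<And>x. x \<notin> K \<Longrightarrow> f x = 0"
  shows "continuous_on UNIV f"
proof -
  have "continuous_on (- K) f"
    using assms(5) by (subst continuous_on_cong[where g = "\<lambda>_. 0"]) auto
  then have "continuous_on (\<Omega> \<union> - K) f"
    using assms by (intro continuous_on_open_Un) auto
  moreover have "\<Omega> \<union> - K = UNIV" using assms(3) by auto
  ultimately show ?thesis by simp
qed

text \<open>Smoothness is assumed on \<open>\<Omega>\<close> only. Off the support everything
  vanishes locally, and \<open>\<Omega>\<close> and the complement of the support form an open
  cover, so the properties hold on the whole space, as translations require.\<close>

lemma test_function_props:
  fixes u :: "'a::euclidean_space \<Rightarrow> real"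
  assumes "open \<Omega>" "u \<in> test_functions \<Omega>"
  defines "K \<equiv> closure {x. u x \<noteq> 0}"
  shows "continuous_on UNIV u"
    and "b \<in> Basis \<Longrightarrow> continuous_on UNIV (pderiv b u)"
    and "b \<in> Basis \<Longrightarrow> x \<notin> K \<Longrightarrow> pderiv b u x = 0"
    and "b \<in> Basis \<Longrightarrow> ((\<lambda>t. u (x + t *\<^sub>R b)) has_real_derivative pderiv b u (x + t *\<^sub>R b)) (at t)"
proof -
  have K: "closed K" "K \<subseteq> \<Omega>" using assms by (auto simp: test_functions_def)
  have u0: "u x = 0" if "x \<notin> K" for x
    using that closure_subset[of "{x. u x \<noteq> 0}"] unfolding K_def by auto
  have "Ck_on (Suc 0) \<Omega> u" using assms(2) unfolding test_functions_def smooth_on_def by blast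
  then have C: "continuous_on \<Omega> u" "\<And>b. b \<in> Basis \<Longrightarrow> continuous_on \<Omega> (pderiv b u)"
    and D: "\<And>x b. x \<in> \<Omega> \<Longrightarrow> b \<in> Basis \<Longrightarrow> (\<lambda>t. u (x + t *\<^sub>R b)) differentiable (at 0)"
    by auto
  show "continuous_on UNIV u"
    by (rule continuous_on_UNIV_extend_zero[OF assms(1) K C(1) u0])
  have off: "((\<lambda>t. u (x + t *\<^sub>R b)) has_real_derivative 0) (at 0)" if "x \<notin> K" for x b
  proof (rule has_field_derivative_transform_within_open[OF DERIV_const])
    show "open ((\<lambda>t. x + t *\<^sub>R b) -` (- K))"
      using K(1) by (intro open_vimage continuous_intros) auto
    show "0 \<in> (\<lambda>t. x + t *\<^sub>R b) -` (- K)" using that by simp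
  qed (simp add: u0)
  show z: "pderiv b u x = 0" if "x \<notin> K" for x b
    unfolding pderiv_def by (rule DERIV_imp_deriv[OF off[OF that]])
  show "continuous_on UNIV (pderiv b u)" if "b \<in> Basis"
    using that by (intro continuous_on_UNIV_extend_zero[OF assms(1) K C(2) z])
  show "((\<lambda>t. u (x + t *\<^sub>R b)) has_real_derivative pderiv b u (x + t *\<^sub>R b)) (at t)" if "b \<in> Basis"
  proof -
    have "((\<lambda>r. u ((x + t *\<^sub>R b) + r *\<^sub>R b)) has_real_derivative pderiv b u (x + t *\<^sub>R b)) (at 0)"
    proof (cases "x + t *\<^sub>R b \<in> K")
      case True
      then show ?thesis
        using D[of "x + t *\<^sub>R b" b] K(2) that by (auto simp: pderiv_def DERIV_deriv_iff_real_differentiable)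
    next
      case False
      then show ?thesis using off[OF False] z[OF False] by simp
    qed
    then show ?thesis by (rule has_real_derivative_on_line)
  qed
qed

text \<open>Uniform continuity on the compact unit neighbourhood of \<open>K\<close> suffices: two
  points closer than 1 either both lie in it or both miss \<open>K\<close>.\<close>

lemma uniformly_continuous_on_compact_support:
  fixes f :: "'a::euclidean_space \<Rightarrow> real"
  assumes "continuous_on UNIV f" "compact K" "\<And>x. x \<notin> K \<Longrightarrow> f x = 0"
  shows "uniformly_continuous_on UNIV f"
proof (cases "K = {}")
  case True
  then have "f = (\<lambda>_. 0)" using assms(3) by auto
  then show ?thesis by (simp add: uniformly_continuous_on_const)
next
  case False
  let ?K1 = "{x. infdist x K \<le> 1}"
  have "compact ?K1" by (rule compact_infdist_le[OF False assms(2)]) simp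
  then have uc: "uniformly_continuous_on ?K1 f"
    using assms(1) by (intro compact_uniformly_continuous) (auto intro: continuous_on_subset)
  show ?thesis
    unfolding uniformly_continuous_on_def
  proof (intro allI impI)
    fix e :: real assume "e > 0"
    then obtain d where d: "d > 0"
      "\<And>x x'. x \<in> ?K1 \<Longrightarrow> x' \<in> ?K1 \<Longrightarrow> dist x' x < d \<Longrightarrow> dist (f x') (f x) < e"
      using uc unfolding uniformly_continuous_on_def by metis
    have "dist (f x') (f x) < e" if "dist x' x < min d 1" for x x'
    proof (cases "x \<in> K \<or> x' \<in> K")
      case True
      then have "infdist x K \<le> 1" "infdist x' K \<le> 1"
        using that infdist_le2[of x K x' 1] infdist_le2[of x' K x 1] by (auto simp: dist_commute)
      then show ?thesis using d(2)[of x x'] that by simp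
    next
      case False
      then show ?thesis using assms(3) \<open>e > 0\<close> by simp
    qed
    then show "\<exists>d>0. \<forall>x\<in>UNIV. \<forall>x'\<in>UNIV. dist x' x < d \<longrightarrow> dist (f x') (f x) < e"
      using d(1) by (intro exI[of _ "min d 1"]) auto
  qed
qed

text \<open>The mean value inequality with uniformly continuous partial derivatives yields a step
  size \<open>\<delta>\<close> that is independent of \<open>x\<close>.\<close>

lemma test_function_increment:
  fixes u :: "'a::euclidean_space \<Rightarrow> real"
  assumes "open \<Omega>" "u \<in> test_functions \<Omega>" "\<eta> > 0"
  obtains \<delta> where "\<delta> > 0" "\<And>x b h. b \<in> Basis \<Longrightarrow> \<bar>h\<bar> < \<delta> \<Longrightarrow>
    \<bar>u (x + h *\<^sub>R b) - u x\<bar> \<le> \<bar>h\<bar> * (\<bar>pderiv b u x\<bar> + \<eta>)"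
proof -
  note props = test_function_props[OF assms(1,2)]
  have K: "compact (closure {x. u x \<noteq> 0})" using assms(2) by (simp add: test_functions_def)
  have "\<forall>b\<in>Basis. \<exists>\<delta>>0. \<forall>x x'. dist x' x < \<delta> \<longrightarrow> dist (pderiv b u x') (pderiv b u x) < \<eta>"
    using uniformly_continuous_on_compact_support[OF props(2) K props(3)] assms(3)
    unfolding uniformly_continuous_on_def by simp
  then obtain D where D: "\<And>b. b \<in> Basis \<Longrightarrow> D b > 0"
    "\<And>b x x'. b \<in> Basis \<Longrightarrow> dist x' x < D b \<Longrightarrow> dist (pderiv b u x') (pderiv b u x) < \<eta>"
    by metis
  show thesis
  proof (rule that[of "Min (D ` Basis)"])
    show "Min (D ` Basis) > 0" using D(1) by simp
    fix x b :: 'a and h :: real assume b: "b \<in> Basis" and h: "\<bar>h\<bar> < Min (D ` Basis)"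
    have "norm (u (x + h *\<^sub>R b) - u (x + 0 *\<^sub>R b)) \<le> (\<bar>pderiv b u x\<bar> + \<eta>) * norm (h - 0)"
    proof (rule field_differentiable_bound[where f = "\<lambda>t. u (x + t *\<^sub>R b)"
          and f' = "\<lambda>t. pderiv b u (x + t *\<^sub>R b)"])
      show "convex {- \<bar>h\<bar>..\<bar>h\<bar>}" by simp
      fix t assume t: "t \<in> {- \<bar>h\<bar>..\<bar>h\<bar>}"
      show "((\<lambda>t. u (x + t *\<^sub>R b)) has_real_derivative pderiv b u (x + t *\<^sub>R b)) (at t within {- \<bar>h\<bar>..\<bar>h\<bar>})"
        by (rule has_field_derivative_at_within[OF props(4)[OF b]])
      have "dist (x + t *\<^sub>R b) x < D b"
        using t h b by (auto simp: dist_norm)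
      from D(2)[OF b this] show "norm (pderiv b u (x + t *\<^sub>R b)) \<le> \<bar>pderiv b u x\<bar> + \<eta>"
        by (simp add: dist_real_def)
    qed auto
    then show "\<bar>u (x + h *\<^sub>R b) - u x\<bar> \<le> \<bar>h\<bar> * (\<bar>pderiv b u x\<bar> + \<eta>)"
      by (simp add: mult.commute)
  qed
qed

text \<open>Cauchy-Schwarz for the vectors of absolute coordinates. It reassembles the axis-wise
  estimates into the Euclidean norm of the gradient with constant 1.\<close>

lemma sum_abs_inner_Basis_le:
  fixes p q :: "'a::euclidean_space"
  shows "(\<Sum>b\<in>Basis. \<bar>p \<bullet> b\<bar> * \<bar>q \<bullet> b\<bar>) \<le> norm p * norm q"
proof -
  have "norm x = L2_set (\<lambda>b. x \<bullet> b) Basis" for x :: 'a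
    unfolding L2_set_def norm_eq_sqrt_inner by (subst euclidean_inner) (simp add: power2_eq_square)
  then show ?thesis using L2_set_mult_ineq[of "\<lambda>b. p \<bullet> b" "\<lambda>b. q \<bullet> b" Basis] by simp
qed

lemma grad_inner_Basis: "b \<in> Basis \<Longrightarrow> grad u x \<bullet> b = pderiv b u x"
  unfolding grad_def by (simp add: inner_sum_left_Basis)

text \<open>After summation by parts, increments of \<open>w\<close> meet only nonnegative factors,
  so supergradients bound them. The linear terms sum to at most
  \<open>norm p * norm (grad u x)\<close>, while the quadratic terms are of order \<open>e\<close>
  after division by \<open>e\<^sup>2\<close>.\<close>

lemma second_difference_estimate:
  fixes u w g :: "'a::euclidean_space \<Rightarrow> real"
  assumes "open \<Omega>" "u \<in> test_functions \<Omega>"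
  defines "K \<equiv> closure {x. u x \<noteq> 0}"
  assumes w: "continuous_on UNIV w" and g: "continuous_on UNIV g"
    and "\<rho> > 0" "C \<ge> 0" "\<epsilon> > 0"
    and semi: "\<And>x. infdist x K \<le> \<rho> \<Longrightarrow> \<exists>p. norm p \<le> g x \<and>
      (\<forall>h. norm h \<le> \<rho> \<longrightarrow> w (x + h) \<le> w x + p \<bullet> h + C * (norm h)\<^sup>2)"
  shows "\<forall>\<^sub>F e in at_right 0.
    - (LINT x|lborel. \<bar>u x\<bar> * (\<Sum>b\<in>Basis. (w (x + e *\<^sub>R b) + w (x - e *\<^sub>R b) - 2 * w x) / e\<^sup>2))
      \<le> (LINT x|lborel. norm (grad u x) * g x) + \<epsilon>"
proof -
  note props = test_function_props[OF assms(1,2), folded K_def]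
  have K: "compact K" "K \<noteq> {}"
    using assms(2) by (auto simp: test_functions_def K_def)
  have u0: "u x = 0" if "x \<notin> K" for x
    using that closure_subset[of "{x. u x \<noteq> 0}"] unfolding K_def by auto
  \<comment> \<open>Shifted values of \<open>u\<close> can be nonzero off \<open>K\<close>, but only
    within distance \<open>e \<le> \<rho>\<close> of it.\<close>
  define K' where "K' = {x. infdist x K \<le> \<rho>}"
  have K': "compact K'" unfolding K'_def using K \<open>\<rho> > 0\<close> by (intro compact_infdist_le) auto
  have g0: "g x \<ge> 0" if "x \<in> K'" for x
    using semi[of x] that norm_ge_zero order_trans unfolding K'_def by blast
  \<comment> \<open>\<open>R1\<close> weighs the error \<open>\<eta>\<close> in the increments of
    \<open>u\<close>, and \<open>R2\<close> the semiconcavity error. Cutting off to the compact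
    \<open>K'\<close> makes both integrable.\<close>
  define R1 where "R1 x = indicator K' x *\<^sub>R (real DIM('a) * g x)" for x
  define R2 where "R2 x = indicator K' x *\<^sub>R (2 * C * (\<Sum>b\<in>Basis. \<bar>pderiv b u x\<bar> + 1))" for x
  have cp: "continuous_on S (pderiv b u)" if "b \<in> Basis" for S b
    using continuous_on_subset[OF props(2)[OF that]] by simp
  have cg: "continuous_on S g" for S using continuous_on_subset[OF g] by simp
  have iR: "integrable lborel R1" "integrable lborel R2"
    unfolding R1_def R2_def
    by (intro borel_integrable_compact[OF K'] continuous_intros cg cp; assumption)+
  have R0: "R1 x \<ge> 0" "R2 x \<ge> 0" for x
    using g0[of x] \<open>C \<ge> 0\<close> by (auto simp: R1_def R2_def indicator_def intro!: mult_nonneg_nonneg sum_nonneg)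
  define I1 where "I1 = (LINT x|lborel. R1 x)"
  define I2 where "I2 = (LINT x|lborel. R2 x)"
  have I0: "I1 \<ge> 0" "I2 \<ge> 0" using R0 by (simp_all add: I1_def I2_def)
  have grad0: "grad u x = 0" if "x \<notin> K" for x
    using props(3) that by (simp add: grad_def)
  have cgrad: "continuous_on UNIV (grad u)"
    unfolding grad_def by (intro continuous_intros cp)
  have ig: "integrable lborel (\<lambda>x. norm (grad u x) * g x)"
    by (rule integrable_lborel_compact_support[OF _ K(1)])
      (auto intro!: continuous_intros cgrad g simp: grad0)
  have half: "\<epsilon> / (2 * J) * J = \<epsilon> / 2" if "J > 0" for J using that by simp
  \<comment> \<open>Half of \<open>\<epsilon>\<close> goes to \<open>R1\<close> and half to
    \<open>R2\<close>. The cap 1 allows \<open>R2\<close> to be fixed before \<open>\<eta>\<close>,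
    and \<open>I1 + 1\<close> avoids division by zero.\<close>
  define \<eta> where "\<eta> = min 1 (\<epsilon> / (2 * (I1 + 1)))"
  have \<eta>: "\<eta> > 0" "\<eta> \<le> 1" "\<eta> * I1 \<le> \<epsilon> / 2"
  proof -
    show "\<eta> > 0" "\<eta> \<le> 1" using I0 \<open>\<epsilon> > 0\<close> by (auto simp: \<eta>_def)
    have "\<eta> * I1 \<le> \<epsilon> / (2 * (I1 + 1)) * (I1 + 1)"
      using I0 \<open>\<epsilon> > 0\<close> by (intro mult_mono) (auto simp: \<eta>_def)
    also have "\<dots> = \<epsilon> / 2" using I0 by (intro half) simp
    finally show "\<eta> * I1 \<le> \<epsilon> / 2" .
  qed
  obtain \<delta> where \<delta>: "\<delta> > 0" "\<And>x b h. b \<in> Basis \<Longrightarrow> \<bar>h\<bar> < \<delta> \<Longrightarrow>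
    \<bar>u (x + h *\<^sub>R b) - u x\<bar> \<le> \<bar>h\<bar> * (\<bar>pderiv b u x\<bar> + \<eta>)"
    using test_function_increment[OF assms(1,2) \<eta>(1)] by metis
  define e0 where "e0 = min (min \<delta> \<rho>) (\<epsilon> / (2 * (I2 + 1)))"
  have e0: "e0 > 0" using \<delta>(1) \<open>\<rho> > 0\<close> I0 \<open>\<epsilon> > 0\<close> by (auto simp: e0_def)
  have main: "- (LINT x|lborel. \<bar>u x\<bar> * (\<Sum>b\<in>Basis. (w (x + e *\<^sub>R b) + w (x - e *\<^sub>R b) - 2 * w x) / e\<^sup>2))
      \<le> (LINT x|lborel. norm (grad u x) * g x) + \<epsilon>" if e: "0 < e" "e < e0" for e
  proof -
    have e': "e < \<delta>" "e \<le> \<rho>" using e by (auto simp: e0_def)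
    have eI2: "e * I2 \<le> \<epsilon> / 2"
    proof -
      have "e * I2 \<le> \<epsilon> / (2 * (I2 + 1)) * (I2 + 1)"
        using I0 e by (intro mult_mono) (auto simp: e0_def)
      also have "\<dots> = \<epsilon> / 2" using I0 by (intro half) simp
      finally show ?thesis .
    qed
    define Q where "Q b x = max 0 (\<bar>u (x + e *\<^sub>R b)\<bar> - \<bar>u x\<bar>) * (w (x + e *\<^sub>R b) - w x)
      + max 0 (\<bar>u (x - e *\<^sub>R b)\<bar> - \<bar>u x\<bar>) * (w (x - e *\<^sub>R b) - w x)" for b x
    define T where "T b x = \<bar>u x\<bar> * (w (x + e *\<^sub>R b) + w (x - e *\<^sub>R b) - 2 * w x)" for b x
    have cu: "continuous_on UNIV (\<lambda>x. \<bar>u x\<bar>)" by (intro continuous_intros props(1))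
    have Q: "integrable lborel (Q b)" "- (LINT x|lborel. T b x) = (LINT x|lborel. Q b x)" for b
      unfolding Q_def T_def using second_difference_by_parts[OF cu w K(1), of "e *\<^sub>R b"] u0 by simp_all
    have iT: "integrable lborel (T b)" for b
      unfolding T_def using u0
      by (intro integrable_lborel_compact_support[OF _ K(1)] continuous_intros cu
          continuous_on_compose2[OF w _ subset_UNIV]) auto
    have pw: "(\<Sum>b\<in>Basis. Q b x / e\<^sup>2) \<le> norm (grad u x) * g x + \<eta> * R1 x + e * R2 x" for x
    proof (cases "x \<in> K'")
      case False
      have out: "y \<notin> K" if "dist x y \<le> \<rho>" for y
      proof
        assume "y \<in> K"
        then show False using infdist_le2[of y K x \<rho>] that False by (simp add: K'_def)
      qed
      have "Q b x = 0" if "b \<in> Basis" for b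
        using out[of "x + e *\<^sub>R b"] out[of "x - e *\<^sub>R b"] e e' that u0
        by (simp add: Q_def dist_norm)
      moreover have "x \<notin> K" using out[of x] \<open>\<rho> > 0\<close> by simp
      ultimately show ?thesis using R0[of x] \<eta>(1) e by (simp add: grad0)
    next
      case True
      then obtain p where p: "norm p \<le> g x"
        "\<And>h. norm h \<le> \<rho> \<Longrightarrow> w (x + h) \<le> w x + p \<bullet> h + C * (norm h)\<^sup>2"
        using semi[of x] by (auto simp: K'_def)
      have Qb: "Q b x / e\<^sup>2 \<le> \<bar>p \<bullet> b\<bar> * \<bar>grad u x \<bullet> b\<bar> + \<eta> * g x + e * (2 * C * (\<bar>pderiv b u x\<bar> + 1))"
        if b: "b \<in> Basis" for b
      proof -
        define a where "a = \<bar>pderiv b u x\<bar> + \<eta>"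
        define A where "A = max 0 (\<bar>u (x + e *\<^sub>R b)\<bar> - \<bar>u x\<bar>)"
        define B where "B = max 0 (\<bar>u (x - e *\<^sub>R b)\<bar> - \<bar>u x\<bar>)"
        have a0: "a \<ge> 0" using \<eta> by (simp add: a_def)
        have "\<bar>u (x + e *\<^sub>R b) - u x\<bar> \<le> e * a" "\<bar>u (x - e *\<^sub>R b) - u x\<bar> \<le> e * a"
          using \<delta>(2)[OF b, of e x] \<delta>(2)[OF b, of "- e" x] e e' by (simp_all add: a_def)
        then have AB: "0 \<le> A" "A \<le> e * a" "0 \<le> B" "B \<le> e * a"
          using a0 e by (auto simp: A_def B_def)
        have "w (x + e *\<^sub>R b) - w x \<le> e * (p \<bullet> b) + C * e\<^sup>2"
          using p(2)[of "e *\<^sub>R b"] b e e' by simp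
        then have q1: "A * (w (x + e *\<^sub>R b) - w x) \<le> A * (e * (p \<bullet> b) + C * e\<^sup>2)"
          using AB by (intro mult_left_mono)
        have "w (x - e *\<^sub>R b) - w x \<le> - (e * (p \<bullet> b)) + C * e\<^sup>2"
          using p(2)[of "- e *\<^sub>R b"] b e e' by simp
        then have q2: "B * (w (x - e *\<^sub>R b) - w x) \<le> B * (- (e * (p \<bullet> b)) + C * e\<^sup>2)"
          using AB by (intro mult_left_mono)
        \<comment> \<open>Both \<open>A\<close> and \<open>B\<close> lie between 0 and
          \<open>e * a\<close>, so their difference is at most \<open>e * a\<close> in absolute
          value. A bound by the sum would lose a factor 2 in the gradient term.\<close>
        have "(A - B) * (p \<bullet> b) \<le> \<bar>A - B\<bar> * \<bar>p \<bullet> b\<bar>"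
          by (metis abs_ge_self abs_mult)
        also have "\<dots> \<le> (e * a) * \<bar>p \<bullet> b\<bar>"
          using AB by (intro mult_right_mono) auto
        finally have q3: "e * ((A - B) * (p \<bullet> b)) \<le> e * ((e * a) * \<bar>p \<bullet> b\<bar>)"
          using e by (intro mult_left_mono) auto
        have "A + B \<le> 2 * (e * a)" using AB by simp
        then have q4: "(C * e\<^sup>2) * (A + B) \<le> (C * e\<^sup>2) * (2 * (e * a))"
          using \<open>C \<ge> 0\<close> by (intro mult_left_mono) auto
        have "Q b x \<le> e * ((A - B) * (p \<bullet> b)) + (C * e\<^sup>2) * (A + B)"
          using q1 q2 by (simp add: Q_def A_def[symmetric] B_def[symmetric] algebra_simps)
        also have "\<dots> \<le> e * ((e * a) * \<bar>p \<bullet> b\<bar>) + (C * e\<^sup>2) * (2 * (e * a))"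
          using q3 q4 by linarith
        finally have "Q b x / e\<^sup>2 \<le> (e * ((e * a) * \<bar>p \<bullet> b\<bar>) + (C * e\<^sup>2) * (2 * (e * a))) / e\<^sup>2"
          by (intro divide_right_mono) auto
        also have "\<dots> = \<bar>p \<bullet> b\<bar> * \<bar>grad u x \<bullet> b\<bar> + \<eta> * \<bar>p \<bullet> b\<bar> + e * (2 * C * a)"
          using e by (simp add: a_def grad_inner_Basis[OF b] field_simps power2_eq_square)
        also have "\<dots> \<le> \<bar>p \<bullet> b\<bar> * \<bar>grad u x \<bullet> b\<bar> + \<eta> * g x + e * (2 * C * (\<bar>pderiv b u x\<bar> + 1))"
          using Basis_le_norm[OF b, of p] p(1) \<eta> e \<open>C \<ge> 0\<close>
          by (intro add_mono mult_left_mono) (auto simp: a_def)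
        finally show ?thesis .
      qed
      have "(\<Sum>b\<in>Basis. Q b x / e\<^sup>2) \<le> (\<Sum>b\<in>Basis. \<bar>p \<bullet> b\<bar> * \<bar>grad u x \<bullet> b\<bar> + \<eta> * g x
          + e * (2 * C * (\<bar>pderiv b u x\<bar> + 1)))"
        by (intro sum_mono Qb)
      also have "\<dots> = (\<Sum>b\<in>Basis. \<bar>p \<bullet> b\<bar> * \<bar>grad u x \<bullet> b\<bar>) + \<eta> * R1 x + e * R2 x"
        using True by (simp add: sum.distrib R1_def R2_def sum_distrib_left algebra_simps)
      also have "(\<Sum>b\<in>Basis. \<bar>p \<bullet> b\<bar> * \<bar>grad u x \<bullet> b\<bar>) \<le> norm (grad u x) * g x"
        using sum_abs_inner_Basis_le[of p "grad u x"] mult_right_mono[OF p(1), of "norm (grad u x)"]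
        by (simp add: mult.commute)
      finally show ?thesis by simp
    qed
    have "- (LINT x|lborel. \<bar>u x\<bar> * (\<Sum>b\<in>Basis. (w (x + e *\<^sub>R b) + w (x - e *\<^sub>R b) - 2 * w x) / e\<^sup>2))
        = - (LINT x|lborel. (\<Sum>b\<in>Basis. T b x / e\<^sup>2))"
      by (simp add: T_def sum_distrib_left)
    also have "\<dots> = (\<Sum>b\<in>Basis. - (LINT x|lborel. T b x) / e\<^sup>2)"
      using iT by (simp add: Bochner_Integration.integral_sum sum_negf)
    also have "\<dots> = (LINT x|lborel. (\<Sum>b\<in>Basis. Q b x / e\<^sup>2))"
      using Q by (simp add: Bochner_Integration.integral_sum)
    also have "\<dots> \<le> (LINT x|lborel. norm (grad u x) * g x + \<eta> * R1 x + e * R2 x)"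
      using Q ig iR pw by (intro integral_mono) auto
    also have "\<dots> = (LINT x|lborel. norm (grad u x) * g x) + \<eta> * I1 + e * I2"
      using ig iR by (simp add: I1_def I2_def)
    also have "\<dots> \<le> (LINT x|lborel. norm (grad u x) * g x) + \<epsilon>"
      using \<eta> eI2 by linarith
    finally show ?thesis .
  qed
  show ?thesis
    unfolding eventually_at_right_field using e0 main by (intro exI[of _ e0]) auto
qed

section \<open>The weighted Hardy inequality and the conclusion\<close>

text \<open>Fatou's lemma combines the pointwise Laplacian bound with the integral estimate, for a
  weight \<open>w\<close> made continuous on the whole space by truncating the distance. Strict
  positivity of the denominator permits the later division.\<close>

lemma hardy_integral_inequality:
  fixes \<Omega> :: "'a::euclidean_space set" and s :: real
  assumes "open \<Omega>" "\<Omega> \<noteq> UNIV" "C2_boundary \<Omega>" "s \<ge> 1" "u \<in> test_functions \<Omega>"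
    and curv: "\<And>y. y \<in> frontier \<Omega> \<Longrightarrow> l \<le> curvature_sum \<Omega> y"
  shows "l * (LINT x:\<Omega>|lborel. \<bar>u x\<bar> * dist_bd \<Omega> x powr (1 - s))
      \<le> (LINT x:\<Omega>|lborel. norm (grad u x) * dist_bd \<Omega> x powr (1 - s))
        - (s - 1) * (LINT x:\<Omega>|lborel. \<bar>u x\<bar> * dist_bd \<Omega> x powr (- s))"
    and "(LINT x:\<Omega>|lborel. \<bar>u x\<bar> * dist_bd \<Omega> x powr (1 - s)) > 0"
proof -
  define K where "K = closure {x. u x \<noteq> 0}"
  note props = test_function_props[OF assms(1,5), folded K_def]
  obtain x0 where x0: "u x0 \<noteq> 0" using assms(5) by (auto simp: test_functions_def)
  have K: "compact K" "K \<noteq> {}" "K \<subseteq> \<Omega>"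
    using assms(5) by (auto simp: test_functions_def K_def)
  have uK: "x \<in> K" if "u x \<noteq> 0" for x
    using that closure_subset[of "{x. u x \<noteq> 0}"] unfolding K_def by auto
  have grad0: "grad u x = 0" if "x \<notin> K" for x
    using props(3) that by (simp add: grad_def)
  let ?d = "\<lambda>x. infdist x (- \<Omega>)"
  have cd: "continuous_on S ?d" for S by (intro continuous_intros)
  obtain z where z: "z \<in> K" "\<And>x. x \<in> K \<Longrightarrow> ?d z \<le> ?d x"
    using continuous_attains_inf[OF K(1,2) cd] by blast
  have "?d z > 0" using nearest_point[OF assms(1,2)] z(1) K(3) by blast
  \<comment> \<open>The distance is at least \<open>3 * \<rho>\<close> on \<open>K\<close>, hence at
    least \<open>2 * \<rho>\<close> on its \<open>\<rho>\<close>-neighbourhood, and still at least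
    \<open>\<rho>\<close> after one further shift of length \<open>\<rho>\<close>.\<close>
  define \<rho> where "\<rho> = ?d z / 3"
  have \<rho>: "\<rho> > 0" using \<open>?d z > 0\<close> by (simp add: \<rho>_def)
  have dK: "?d x \<ge> 3 * \<rho>" if "x \<in> K" for x using z(2)[OF that] by (simp add: \<rho>_def)
  have dK': "?d x \<ge> 2 * \<rho>" if x: "infdist x K \<le> \<rho>" for x
  proof -
    obtain y where "y \<in> K" "infdist x K = dist x y"
      using infdist_attains_inf[OF compact_imp_closed[OF K(1)] K(2)] by blast
    then show ?thesis using dK[of y] infdist_triangle[of y "- \<Omega>" x] x by (simp add: dist_commute)
  qed
  \<comment> \<open>The truncation keeps powers and the primitive continuous everywhere, and by the
    choice of \<open>\<rho>\<close> it is inactive wherever the estimates evaluate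
    \<open>w\<close>.\<close>
  define d where "d x = max \<rho> (?d x)" for x
  have d_pos: "d x > 0" for x using \<rho> by (simp add: d_def)
  have d_eq: "d x = ?d x" if "x \<in> K" for x using dK[OF that] \<rho> by (simp add: d_def)
  have cont_d: "continuous_on UNIV d" unfolding d_def by (intro continuous_intros cd)
  define w where "w x = powr_primitive s (d x)" for x
  have "continuous_on {0<..} (powr_primitive s)"
    using DERIV_powr_primitive by (intro continuous_at_imp_continuous_on) (auto intro: DERIV_isCont)
  then have cw: "continuous_on UNIV w"
    unfolding w_def using d_pos by (intro continuous_on_compose2[OF _ cont_d]) auto
  have cpow: "continuous_on UNIV (\<lambda>x. d x powr t)" for t
    using cont_d d_pos by (intro continuous_intros) (auto simp: less_imp_neq[symmetric])
  have cu: "continuous_on UNIV (\<lambda>x. \<bar>u x\<bar>)" by (intro continuous_intros props(1))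
  have semi: "\<exists>p. norm p \<le> d x powr (1 - s) \<and>
      (\<forall>h. norm h \<le> \<rho> \<longrightarrow> w (x + h) \<le> w x + p \<bullet> h + \<rho> powr (- s) * (norm h)\<^sup>2)"
    if x: "infdist x K \<le> \<rho>" for x
  proof -
    have dx: "d x = ?d x" using dK'[OF x] \<rho> by (simp add: d_def)
    obtain p where p: "norm p = ?d x powr (1 - s)"
      "\<And>h. norm h \<le> \<rho> \<Longrightarrow> powr_primitive s (?d (x + h))
        \<le> powr_primitive s (?d x) + p \<bullet> h + \<rho> powr (- s) * (norm h)\<^sup>2"
      using semiconcave_powr_primitive_infdist[OF assms(1,2,4) \<rho> dK'[OF x]] by metis
    have "w (x + h) = powr_primitive s (?d (x + h))" if h: "norm h \<le> \<rho>" for h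
    proof -
      have "?d x \<le> ?d (x + h) + norm h"
        using infdist_triangle[of x "- \<Omega>" "x + h"] by (simp add: dist_norm)
      then show ?thesis using h dK'[OF x] by (simp add: w_def d_def)
    qed
    then show ?thesis using p by (intro exI[of _ p]) (auto simp: w_def dx)
  qed
  define L where "L e x = (\<Sum>b\<in>Basis. (w (x + e *\<^sub>R b) + w (x - e *\<^sub>R b) - 2 * w x) / e\<^sup>2)" for e x
  \<comment> \<open>The negative of the pointwise upper bound for the Laplacian of
    \<open>w\<close>.\<close>
  define \<Lambda> where "\<Lambda> x = (s - 1) * d x powr (- s) + l * d x powr (1 - s)" for x
  have L_bound: "L e x \<le> 2 * \<rho> powr (- s) * real DIM('a)"
    if "x \<in> K" "0 < e" "e \<le> \<rho>" for e x
  proof -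
    have "infdist x K \<le> \<rho>" using that \<rho> by simp
    then obtain p where p: "\<And>h. norm h \<le> \<rho> \<Longrightarrow> w (x + h) \<le> w x + p \<bullet> h + \<rho> powr (- s) * (norm h)\<^sup>2"
      using semi by blast
    have "(w (x + e *\<^sub>R b) + w (x - e *\<^sub>R b) - 2 * w x) / e\<^sup>2 \<le> 2 * \<rho> powr (- s)" if b: "b \<in> Basis" for b
    proof -
      \<comment> \<open>The linear terms at \<open>e *\<^sub>R b\<close> and
        \<open>- (e *\<^sub>R b)\<close> cancel, leaving twice the quadratic one.\<close>
      have "w (x + e *\<^sub>R b) + w (x - e *\<^sub>R b) - 2 * w x \<le> 2 * \<rho> powr (- s) * e\<^sup>2"
        using p[of "e *\<^sub>R b"] p[of "- (e *\<^sub>R b)"] b \<open>0 < e\<close> \<open>e \<le> \<rho>\<close> by simp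
      then show ?thesis using \<open>0 < e\<close> by (simp add: field_simps)
    qed
    then have "L e x \<le> (\<Sum>b\<in>(Basis :: 'a set). 2 * \<rho> powr (- s))"
      unfolding L_def by (intro sum_mono)
    then show ?thesis by (simp add: mult_ac)
  qed
  have L_lim: "\<forall>\<^sub>F e in at_right 0. L e x < - \<Lambda> x + \<eta>" if "x \<in> K" "\<eta> > 0" for x \<eta>
  proof -
    have "\<forall>\<^sub>F e in at_right 0. e < \<rho>" "\<forall>\<^sub>F e::real in at_right 0. 0 < e"
      using \<rho> by (auto simp: eventually_at_right_field)
    moreover have "\<forall>\<^sub>F e in at_right 0. (\<Sum>b\<in>Basis. (powr_primitive s (?d (x + e *\<^sub>R b))
        + powr_primitive s (?d (x - e *\<^sub>R b)) - 2 * powr_primitive s (?d x)) / e\<^sup>2)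
        < (1 - s) * ?d x powr (- s) - l * ?d x powr (1 - s) + \<eta>"
      by (rule second_difference_infdist_le[OF assms(1-3)]) (use that K(3) curv in auto)
    ultimately show ?thesis
    proof eventually_elim
      case (elim e)
      have dx: "d x = ?d x" using d_eq[OF \<open>x \<in> K\<close>] .
      have "d (x + h) = ?d (x + h)" if "norm h \<le> \<rho>" for h
        using infdist_triangle[of x "- \<Omega>" "x + h"] that dK[OF \<open>x \<in> K\<close>] \<rho>
        by (simp add: d_def dist_norm)
      from this[of "e *\<^sub>R b" for b] this[of "- (e *\<^sub>R b)" for b]
      have "L e x = (\<Sum>b\<in>Basis. (powr_primitive s (?d (x + e *\<^sub>R b)) + powr_primitive s (?d (x - e *\<^sub>R b))
          - 2 * powr_primitive s (?d x)) / e\<^sup>2)"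
        unfolding L_def w_def dx using elim by (intro sum.cong) auto
      then show ?case using elim by (simp add: \<Lambda>_def dx algebra_simps)
    qed
  qed
  \<comment> \<open>Fatou's lemma is stated for sequences, so the limit from the right is sampled
    along steps in \<open>(0, \<rho>]\<close>.\<close>
  define ek where "ek k = \<rho> / real (Suc k)" for k
  have ek: "0 < ek k" "ek k \<le> \<rho>" for k using \<rho> by (auto simp: ek_def field_simps)
  have "ek \<longlonglongrightarrow> 0"
    unfolding ek_def by (rule LIMSEQ_Suc) (rule lim_const_over_n)
  then have ek_lim: "filterlim ek (at_right 0) sequentially"
    using ek(1) by (intro tendsto_imp_filterlim_at_right) auto
  have icu: "integrable lborel (\<lambda>x. \<bar>u x\<bar> * f x)" if "continuous_on UNIV f" for f
    using uK that by (intro integrable_lborel_compact_support[OF _ K(1)] continuous_intros cu) auto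
  have cL: "continuous_on UNIV (L e)" if "e > 0" for e
    unfolding L_def using that
    by (intro continuous_intros cw continuous_on_compose2[OF cw _ subset_UNIV]) auto
  have c\<Lambda>: "continuous_on UNIV \<Lambda>" unfolding \<Lambda>_def by (intro continuous_intros cpow)
  have main: "(LINT x|lborel. \<bar>u x\<bar> * \<Lambda> x) \<le> (LINT x|lborel. norm (grad u x) * d x powr (1 - s))"
  proof (rule fatou_weighted_upper[where L = "\<lambda>k. L (ek k)" and C = "2 * \<rho> powr (- s) * real DIM('a)"])
    show "integrable lborel (\<lambda>x. \<bar>u x\<bar>)" using icu[of "\<lambda>_. 1"] by simp
    show "integrable lborel (\<lambda>x. \<bar>u x\<bar> * \<Lambda> x)" by (rule icu[OF c\<Lambda>])
    show "integrable lborel (\<lambda>x. \<bar>u x\<bar> * L (ek k) x)" for k by (rule icu[OF cL[OF ek(1)]])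
    show "L (ek k) x \<le> 2 * \<rho> powr (- s) * real DIM('a)" if "\<bar>u x\<bar> \<noteq> 0" for k x
      using that uK ek by (intro L_bound) auto
    show "\<forall>\<^sub>F k in sequentially. L (ek k) x < - \<Lambda> x + \<eta>" if "\<bar>u x\<bar> \<noteq> 0" "\<eta> > 0" for x \<eta>
      using that uK by (intro eventually_compose_filterlim[OF L_lim ek_lim]) auto
    show "\<forall>\<^sub>F k in sequentially. - (LINT x|lborel. \<bar>u x\<bar> * L (ek k) x)
        \<le> (LINT x|lborel. norm (grad u x) * d x powr (1 - s)) + \<epsilon>" if "\<epsilon> > 0" for \<epsilon>
    proof -
      have "\<forall>\<^sub>F e in at_right 0. - (LINT x|lborel. \<bar>u x\<bar> * L e x)
          \<le> (LINT x|lborel. norm (grad u x) * d x powr (1 - s)) + \<epsilon>"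
        unfolding L_def
        by (rule second_difference_estimate[OF assms(1,5) cw cpow \<rho> _ that, where C = "\<rho> powr (- s)"])
          (use semi in \<open>auto simp: K_def\<close>)
      then show ?thesis by (rule eventually_compose_filterlim[OF _ ek_lim])
    qed
  qed simp
  \<comment> \<open>On \<open>K\<close> the truncated and true distances agree, and off
    \<open>K\<close> the integrand vanishes, so the integral over \<open>\<Omega>\<close> becomes
    one over the whole space.\<close>
  have u_set: "(LINT x:\<Omega>|lborel. \<bar>u x\<bar> * dist_bd \<Omega> x powr t) = (LINT x|lborel. \<bar>u x\<bar> * d x powr t)" for t
  proof -
    have "indicator \<Omega> x *\<^sub>R (\<bar>u x\<bar> * dist_bd \<Omega> x powr t) = \<bar>u x\<bar> * d x powr t" for x
      using uK[of x] K(3) d_eq[of x] by (cases "x \<in> K") (auto simp: dist_bd_def)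
    then show ?thesis by (simp only: set_lebesgue_integral_def)
  qed
  have grad_set: "(LINT x:\<Omega>|lborel. norm (grad u x) * dist_bd \<Omega> x powr t)
      = (LINT x|lborel. norm (grad u x) * d x powr t)" for t
  proof -
    have "indicator \<Omega> x *\<^sub>R (norm (grad u x) * dist_bd \<Omega> x powr t) = norm (grad u x) * d x powr t" for x
      using grad0[of x] K(3) d_eq[of x] by (cases "x \<in> K") (auto simp: dist_bd_def)
    then show ?thesis by (simp only: set_lebesgue_integral_def)
  qed
  have "(LINT x|lborel. \<bar>u x\<bar> * \<Lambda> x)
      = (s - 1) * (LINT x|lborel. \<bar>u x\<bar> * d x powr (- s)) + l * (LINT x|lborel. \<bar>u x\<bar> * d x powr (1 - s))"
  proof -
    have "(\<lambda>x. \<bar>u x\<bar> * \<Lambda> x) = (\<lambda>x. (s - 1) * (\<bar>u x\<bar> * d x powr (- s)) + l * (\<bar>u x\<bar> * d x powr (1 - s)))"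
      by (simp add: \<Lambda>_def fun_eq_iff algebra_simps)
    then show ?thesis using icu[OF cpow] by simp
  qed
  then show "l * (LINT x:\<Omega>|lborel. \<bar>u x\<bar> * dist_bd \<Omega> x powr (1 - s))
      \<le> (LINT x:\<Omega>|lborel. norm (grad u x) * dist_bd \<Omega> x powr (1 - s))
        - (s - 1) * (LINT x:\<Omega>|lborel. \<bar>u x\<bar> * dist_bd \<Omega> x powr (- s))"
    unfolding u_set grad_set using main by linarith
  show "(LINT x:\<Omega>|lborel. \<bar>u x\<bar> * dist_bd \<Omega> x powr (1 - s)) > 0"
    unfolding u_set
  proof (rule integral_pos_continuous[OF _ icu[OF cpow]])
    show "continuous_on UNIV (\<lambda>x. \<bar>u x\<bar> * d x powr (1 - s))" by (intro continuous_intros cu cpow)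
    show "\<bar>u x0\<bar> * d x0 powr (1 - s) > 0" using x0 d_pos[of x0] by simp
  qed simp
qed

theorem theorem4p2:
  fixes \<Omega> :: "'a::euclidean_space set" and s :: real
  assumes "DIM('a) \<ge> 2"
    and "open \<Omega>" and "connected \<Omega>" and "\<Omega> \<noteq> {}" and "\<Omega> \<noteq> UNIV"
    and "C2_boundary \<Omega>"
    and "uniform_interior_sphere \<Omega>"
    and "s \<ge> 1"
  shows "ereal (real (DIM('a) - 1)) * (INF y\<in>frontier \<Omega>. ereal (mean_curvature \<Omega> y)) \<le> B1 \<Omega> s"
proof -
  let ?n = "real (DIM('a) - 1)"
  let ?I = "INF y\<in>frontier \<Omega>. ereal (mean_curvature \<Omega> y)"
  have n: "?n > 0" using assms(1) by simp
  obtain x where "x \<in> \<Omega>" using assms(4) by blast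
  then obtain y0 where "y0 \<in> frontier \<Omega>" using nearest_point[OF assms(2,5)] by blast
  then have upper: "?I \<le> ereal (mean_curvature \<Omega> y0)" by (rule INF_lower)
  show ?thesis
  \<comment> \<open>The infimum may be minus infinity, which makes the claim trivial; the frontier
    point \<open>y0\<close> rules out plus infinity.\<close>
  proof (cases ?I)
    case MInf
    then show ?thesis using n by simp
  next
    case PInf
    then show ?thesis using upper by simp
  next
    case (real m)
    have l: "?n * m \<le> curvature_sum \<Omega> y" if "y \<in> frontier \<Omega>" for y
    proof -
      have "ereal m \<le> ereal (mean_curvature \<Omega> y)"
        unfolding real[symmetric] using that by (rule INF_lower)
      then show ?thesis using n by (simp add: mean_curvature_def field_simps)
    qed
    show ?thesis
      unfolding B1_def real
    proof (rule INF_greatest)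
      fix u assume u: "u \<in> test_functions \<Omega>"
      show "ereal ?n * ereal m \<le> ereal (((LINT x:\<Omega>|lborel. norm (grad u x) * dist_bd \<Omega> x powr (1 - s))
             - (s - 1) * (LINT x:\<Omega>|lborel. \<bar>u x\<bar> * dist_bd \<Omega> x powr (- s)))
            / (LINT x:\<Omega>|lborel. \<bar>u x\<bar> * dist_bd \<Omega> x powr (1 - s)))"
        using hardy_integral_inequality[OF assms(2,5,6,8) u, of "?n * m"] l
        by (simp add: pos_le_divide_eq)
    qed
  qed
qed

end
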